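(* For every integer $n \geq 2$, \[ \mathrm{ex}(Q_n,C_{10}) > \frac{1}{8}\, e(Q_n). \]
   Context: The $n$-dimensional hypercube $Q_n$ is the graph with vertex set $\{0,1\}^n$ in which two vertices are adjacent if they differ in exactly one coordinate. $C_{10}$ denotes the cycle of length $10$. A copy of a graph $H$ in a graph $G$ is a (not necessarily induced) subgraph of $G$ isomorphic to $H$; $G$ is $H$-free if it contains no copy of $H$. $\mathrm{ex}(Q_n,H)$ is the maximum number of edges in an $H$-free subgraph of $Q_n$. Write $e(G)=|E(G)|$. *)

theory Defs
  imports Complex_Main
begin

text \<open>A graph is a pair of a vertex set and a set of edges, an edge being a two-element
  set of vertices.\<close>

type_synonym 'a graph = "'a set \<times> 'a set set"

definition verts :: "'a graph \<Rightarrow> 'a set" where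
  "verts G = fst G"

definition edges :: "'a graph \<Rightarrow> 'a set set" where
  "edges G = snd G"

definition is_graph :: "'a graph \<Rightarrow> bool" where
  "is_graph G \<longleftrightarrow> (\<forall>e \<in> edges G. e \<subseteq> verts G \<and> card e = 2)"

definition num_edges :: "'a graph \<Rightarrow> nat" where
  "num_edges G = card (edges G)"

definition subgraph :: "'a graph \<Rightarrow> 'a graph \<Rightarrow> bool" where
  "subgraph K G \<longleftrightarrow> is_graph K \<and> verts K \<subseteq> verts G \<and> edges K \<subseteq> edges G"

definition isomorphic :: "'a graph \<Rightarrow> 'b graph \<Rightarrow> bool" where
  "isomorphic G H \<longleftrightarrow> (\<exists>f. bij_betw f (verts G) (verts H) \<and>
     (\<forall>u \<in> verts G. \<forall>v \<in> verts G. {u, v} \<in> edges G \<longleftrightarrow> {f u, f v} \<in> edges H))"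

definition is_copy :: "'a graph \<Rightarrow> 'b graph \<Rightarrow> 'a graph \<Rightarrow> bool" where
  "is_copy K H G \<longleftrightarrow> subgraph K G \<and> isomorphic K H"

definition free_of :: "'b graph \<Rightarrow> 'a graph \<Rightarrow> bool" where
  "free_of H G \<longleftrightarrow> (\<nexists>K. is_copy K H G)"

definition ex_num :: "'a graph \<Rightarrow> 'b graph \<Rightarrow> nat" where
  "ex_num G H = Max {num_edges F | F. subgraph F G \<and> free_of H F}"

text \<open>Vertices of the hypercube are 0/1-vectors, encoded as Boolean lists.\<close>

definition hypercube :: "nat \<Rightarrow> bool list graph" where
  "hypercube n =
     ({x. length x = n},
      {{x, y} | x y. length x = n \<and> length y = n \<and> (\<exists>!i. i < n \<and> x ! i \<noteq> y ! i)})"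

text \<open>This is the cycle of length \<open>k\<close> only for \<open>k \<ge> 3\<close>.\<close>

definition cycle_graph :: "nat \<Rightarrow> nat graph" where
  "cycle_graph k = ({..<k}, {{i, (i + 1) mod k} | i. i < k})"

lemma is_graph_hypercube: "is_graph (hypercube n)"
  unfolding is_graph_def
proof
  fix e assume "e \<in> edges (hypercube n)"
  then obtain x y where e: "e = {x, y}" "length x = n" "length y = n"
    and "\<exists>!i. i < n \<and> x ! i \<noteq> y ! i"
    unfolding hypercube_def edges_def by auto
  then have "x \<noteq> y" by blast
  with e show "e \<subseteq> verts (hypercube n) \<and> card e = 2"
    by (simp add: hypercube_def verts_def)
qed

lemma is_graph_cycle_graph:
  assumes "k \<ge> 3"
  shows "is_graph (cycle_graph k)"
  unfolding is_graph_def
proof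
  fix e assume "e \<in> edges (cycle_graph k)"
  then obtain i where e: "e = {i, (i + 1) mod k}" "i < k"
    unfolding cycle_graph_def edges_def by auto
  have "i \<noteq> (i + 1) mod k"
  proof (cases "i + 1 = k")
    case True
    with assms show ?thesis by auto
  next
    case False
    with \<open>i < k\<close> have "i + 1 < k" by linarith
    then show ?thesis by simp
  qed
  moreover have "(i + 1) mod k < k" using assms by simp
  ultimately show "e \<subseteq> verts (cycle_graph k) \<and> card e = 2"
    using e by (simp add: cycle_graph_def verts_def)
qed

text \<open>The maximum defining \<open>ex_num\<close> is over a finite nonempty set as soon as \<open>G\<close> is finite
  and \<open>H\<close> has an edge, since then the empty graph is \<open>H\<close>-free.\<close>

lemma ex_num_set_finite:
  fixes G :: "'a graph" and H :: "'b graph"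
  assumes "finite (edges G)"
  shows "finite {num_edges F | F. subgraph F G \<and> free_of H F}"
proof (rule finite_subset)
  show "{num_edges F | F. subgraph F G \<and> free_of H F} \<subseteq> {..num_edges G}"
  proof clarify
    fix F :: "'a graph"
    assume "subgraph F G"
    then have "edges F \<subseteq> edges G" unfolding subgraph_def by (elim conjE)
    with assms show "num_edges F \<le> num_edges G"
      unfolding num_edges_def by (rule card_mono)
  qed
qed simp

lemma ex_num_set_nonempty:
  fixes G :: "'a graph" and H :: "'b graph"
  assumes "is_graph H" "edges H \<noteq> {}"
  shows "{num_edges F | F. subgraph F G \<and> free_of H F} \<noteq> {}"
proof -
  have "verts H \<noteq> {}"
  proof
    assume "verts H = {}"
    then have "\<forall>e \<in> edges H. e = {} \<and> card e = 2"
      using assms(1) unfolding is_graph_def by blast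
    then show False using assms(2) by auto
  qed
  then have "free_of H ({}, {} :: 'a set set)"
    by (auto simp: free_of_def is_copy_def subgraph_def isomorphic_def verts_def bij_betw_def)
  moreover have "subgraph ({}, {}) G"
    by (simp add: subgraph_def is_graph_def verts_def edges_def)
  ultimately show ?thesis by blast
qed

end

theory Submission
  imports Defs "HOL-Computational_Algebra.Polynomial" "HOL-Computational_Algebra.Primes"
    "HOL-Library.FuncSet"
begin

text \<open>Identify the vertices of the cube with the subsets of \<open>{..<n}\<close>, so that an edge joins some \<open>A\<close> to
\<open>insert i A\<close>. Only edges with \<open>card A\<close> even are considered: that is half of all edges, and a cycle made
of such edges stays within two consecutive layers \<open>k\<close> and \<open>k + 1\<close>. It remains to keep a quarter of the
edges of each layer without creating a 10-cycle there, and a bit more in one layer.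

\<^bold>\<open>Which edges are kept.\<close> For a layer \<open>k\<close>, attach to every \<open>i < n\<close>, and to one additional
index \<open>w = n\<close>, an integer vector \<open>c i\<close> with \<open>k + 1\<close> entries, such that any \<open>k + 1\<close> of these vectors are
linearly independent. A set \<open>A\<close> of size \<open>k\<close> then determines a unique linear functional \<open>\<phi>\<close> over the
rationals with \<open>\<phi> (c w) = 1\<close> that vanishes on \<open>c a\<close> for all \<open>a \<in> A\<close>. The edge from \<open>A\<close> to \<open>insert i A\<close>
is kept if \<open>\<phi> (c i) \<approx> 1\<close>, where \<open>\<approx>\<close> is congruence modulo 3 in the valuation ring of the
rationals at 3.

\<^bold>\<open>A quarter of each layer.\<close> Let the entries be uniform modulo \<open>3 ^ N\<close>, and scale \<open>\<phi>\<close> to a primitive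
integer functional. Its values at \<open>c w\<close> and \<open>c i\<close> are independent and uniform modulo \<open>3 ^ N\<close>, and two such
residues agree in their 3-adic valuation and leading digit with probability \<open>(1 - 1 / 9 ^ N) / 4\<close>.
For large \<open>N\<close>, some choice of entries therefore keeps at least a quarter of the layer
(\<open>exists_dense_layer\<close>). Independence of the vectors costs nothing: modulo a second prime \<open>p > n\<close>
they are made the fixed rows of a Vandermonde matrix (\<open>generic_if_vandermonde_mod\<close>). Layer 0 is a star
and can be kept completely, which makes the final inequality strict.

\<^bold>\<open>No 10-cycle.\<close> A 10-cycle between layers \<open>k\<close> and \<open>k + 1\<close> is a cyclic sequence of five sets with
\<open>A (t + 1) = A t + a t - b t\<close>. Each moved element is added once and removed once, at least one
and at most three steps later: \<open>b (t + d) = a t\<close> with \<open>d \<in> {1, 2, 3}\<close>. This leaves thirteen patterns,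
and five up to rotation. Let \<open>\<phi> t\<close> be the functional of \<open>A t\<close> and \<open>h t = \<phi> t - \<phi> (t + 1)\<close>. The five
functionals \<open>h t\<close> have sum zero, vanish at \<open>w\<close> and on \<open>A t \<inter> A (t + 1)\<close>, and satisfy \<open>h t (a t) \<approx> 1\<close> and
\<open>h t (b t) \<approx> -1\<close>. Moreover, a functional that vanishes at \<open>w\<close> and on some \<open>A t\<close> is zero, which
yields linear relations between the \<open>h t\<close>. In four of the patterns these relations contradict each other
modulo 3 by their signs. In the fifth one, the values \<open>e t = h t (a (t + 1))\<close> satisfy
\<open>e (t + 1) * (1 + e t) \<approx> 1\<close>, up to factors congruent to 1; but \<open>x \<mapsto> 1 / (1 + x)\<close> permutes the four points of the projective line
over the field with three elements cyclically, so five steps do not lead back to the start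
(\<open>no_exchange_cycle\<close>, \<open>no_kept_cycle\<close>).\<close>

section \<open>Congruence modulo 3 of rational numbers\<close>

text \<open>The localization of the integers at the prime 3, as a subring of the rationals.\<close>

definition integral3 :: "rat set" where
  "integral3 = {of_int m / of_int n | m n. \<not> 3 dvd n}"

text \<open>On \<open>integral3\<close> this is congruence modulo 3. Being a relation on all rationals, it can be stated
before any integrality is known; \<open>cong3_integral\<close> then provides the integrality.\<close>

definition cong3 :: "rat \<Rightarrow> rat \<Rightarrow> bool" (infix "\<approx>" 50) where
  "x \<approx> y \<longleftrightarrow> (x - y) / 3 \<in> integral3"

lemma integral3I: "\<not> 3 dvd n \<Longrightarrow> of_int m / of_int n \<in> integral3"
  by (auto simp: integral3_def)

lemma integral3_of_int [simp]: "of_int m \<in> integral3"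
  using integral3I[of 1 m] by simp

lemma integral3_consts [simp]: "0 \<in> integral3" "1 \<in> integral3" "numeral k \<in> integral3"
  using integral3_of_int[of 0] integral3_of_int[of 1] integral3_of_int[of "numeral k"] by simp_all

lemma prime3: "prime (3::int)"
  by simp

lemma integral3_mult: "x \<in> integral3 \<Longrightarrow> y \<in> integral3 \<Longrightarrow> x * y \<in> integral3"
proof -
  assume "x \<in> integral3" "y \<in> integral3"
  then obtain m n m' n' where "x = of_int m / of_int n" "\<not> 3 dvd n"
    "y = of_int m' / of_int n'" "\<not> 3 dvd n'" by (auto simp: integral3_def)
  then show ?thesis
    using integral3I[of "n * n'" "m * m'"] prime_dvd_mult_iff[OF prime3] by simp
qed

lemma integral3_add: "x \<in> integral3 \<Longrightarrow> y \<in> integral3 \<Longrightarrow> x + y \<in> integral3"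
proof -
  assume "x \<in> integral3" "y \<in> integral3"
  then obtain m n m' n' where e: "x = of_int m / of_int n" "\<not> 3 dvd n"
    "y = of_int m' / of_int n'" "\<not> 3 dvd n'" by (auto simp: integral3_def)
  then have "n \<noteq> 0" "n' \<noteq> 0" by auto
  then have "x + y = of_int (m * n' + m' * n) / of_int (n * n')"
    using e by (simp add: field_simps)
  then show ?thesis
    using e integral3I[of "n * n'"] prime_dvd_mult_iff[OF prime3] by metis
qed

lemma integral3_uminus [simp]: "- x \<in> integral3 \<longleftrightarrow> x \<in> integral3"
  using integral3_mult[of "-1" x] integral3_mult[of "-1" "-x"] integral3_of_int[of "-1"] by auto

lemma integral3_diff: "x \<in> integral3 \<Longrightarrow> y \<in> integral3 \<Longrightarrow> x - y \<in> integral3"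
  using integral3_add[of x "-y"] by simp

lemma third_not_integral3: "1 / 3 \<notin> integral3"
proof
  assume "1 / 3 \<in> integral3"
  then obtain m n where e: "1 / 3 = (of_int m / of_int n :: rat)" "\<not> 3 dvd n"
    by (auto simp: integral3_def)
  then have "n \<noteq> 0" by auto
  then have "(of_int n :: rat) = of_int (3 * m)" using e by (simp add: field_simps)
  then have "n = 3 * m" by (simp only: of_int_eq_iff)
  then show False using e by simp
qed

lemma cong3_refl [simp]: "x \<approx> x"
  by (simp add: cong3_def)

lemma cong3_sym: "x \<approx> y \<Longrightarrow> y \<approx> x"
  using integral3_uminus[of "(x - y) / 3"] by (simp add: cong3_def diff_divide_distrib)

lemma cong3_trans [trans]: "x \<approx> y \<Longrightarrow> y \<approx> z \<Longrightarrow> x \<approx> z"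
  using integral3_add[of "(x - y) / 3" "(y - z) / 3"]
  by (simp add: cong3_def diff_divide_distrib)

lemma cong3_integral: "x \<approx> y \<Longrightarrow> y \<in> integral3 \<Longrightarrow> x \<in> integral3"
  using integral3_add[OF integral3_mult[of 3 "(x - y) / 3"], of y]
  by (simp add: cong3_def diff_divide_distrib)

lemma cong3_add: "x \<approx> y \<Longrightarrow> x' \<approx> y' \<Longrightarrow> x + x' \<approx> y + y'"
  using integral3_add[of "(x - y) / 3" "(x' - y') / 3"]
  by (simp add: cong3_def diff_divide_distrib add_divide_distrib algebra_simps)

lemma cong3_uminus: "x \<approx> y \<Longrightarrow> - x \<approx> - y"
  using integral3_uminus[of "(x - y) / 3"]
  by (simp add: cong3_def diff_divide_distrib)

lemma cong3_diff: "x \<approx> y \<Longrightarrow> x' \<approx> y' \<Longrightarrow> x - x' \<approx> y - y'"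
  using cong3_add[OF _ cong3_uminus, of x y x' y'] by simp

lemma cong3_mult:
  assumes "x \<approx> y" "x' \<approx> y'" "y \<in> integral3" "y' \<in> integral3"
  shows "x * x' \<approx> y * y'"
proof -
  have "x * x' - y * y' = (x - y) * x' + y * (x' - y')" by (simp add: algebra_simps)
  then have "(x * x' - y * y') / 3 = (x - y) / 3 * x' + y * ((x' - y') / 3)"
    by (simp add: add_divide_distrib)
  then show ?thesis
    using assms cong3_integral[of x' y'] unfolding cong3_def
    by (metis integral3_add integral3_mult)
qed

lemma not_cong3: "\<not> 1 \<approx> 0" "\<not> 0 \<approx> 1" "\<not> 1 \<approx> -1" "\<not> -1 \<approx> 1" "\<not> -1 \<approx> 0" "\<not> 0 \<approx> -1"
proof -
  have "2 / 3 \<notin> integral3"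
    using integral3_diff[of 1 "2/3"] third_not_integral3 by auto
  moreover have "x \<in> integral3 \<longleftrightarrow> -x \<in> integral3" for x by simp
  ultimately show "\<not> 1 \<approx> 0" "\<not> 0 \<approx> 1" "\<not> 1 \<approx> -1" "\<not> -1 \<approx> 1" "\<not> -1 \<approx> 0" "\<not> 0 \<approx> -1"
    using third_not_integral3 by (simp_all add: cong3_def)
qed

lemma cong3_inverse:
  assumes "x \<approx> 1" shows "1 / x \<approx> 1"
proof -
  have "(x - 1) / 3 \<in> integral3" using assms by (simp add: cong3_def)
  then obtain m n where e: "(x - 1) / 3 = of_int m / of_int n" "\<not> 3 dvd n"
    by (auto simp: integral3_def)
  then have n: "(of_int n :: rat) \<noteq> 0" by auto
  have x: "x = of_int (n + 3 * m) / of_int n" using e n by (simp add: field_simps)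
  have d: "\<not> 3 dvd (n + 3 * m)" using e by (simp add: dvd_add_left_iff)
  then have "n + 3 * m \<noteq> 0" by (metis dvd_0_right)
  then have d0: "(of_int (n + 3 * m) :: rat) \<noteq> 0" by (simp only: of_int_eq_0_iff not_False_eq_True)
  have "1 / x - 1 = (of_int n - of_int (n + 3 * m)) / of_int (n + 3 * m)"
    using n d0 unfolding x by (simp only: diff_divide_distrib) simp
  then have "(1 / x - 1) / 3 = of_int (- m) / of_int (n + 3 * m)" by (simp add: field_simps)
  then show ?thesis using integral3I[OF d, of "-m"] by (simp only: cong3_def)
qed

lemma cong3_divide:
  assumes "x \<approx> s" "y \<approx> t" "s \<in> integral3" "t = 1 \<or> t = -1"
  shows "x / y \<approx> s * t" "y \<noteq> 0"
proof -
  show "y \<noteq> 0" using assms not_cong3 by auto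
  have *: "1 / y \<approx> t"
  proof (cases "t = 1")
    case False
    then have "t = -1" using assms by auto
    then show ?thesis using cong3_uminus[OF cong3_inverse[of "-y"]] cong3_uminus[of y "-1"] assms by simp
  qed (use assms cong3_inverse in auto)
  show "x / y \<approx> s * t" using cong3_mult[OF assms(1) *] assms by auto
qed

text \<open>A rational number outside the valuation ring is the point at infinity of the projective line over
the residue field.\<close>

lemma not_integral3_inverse:
  assumes "x \<notin> integral3" shows "1 / x \<approx> 0"
proof -
  obtain m n where x: "x = Fract m n" "n > 0" "coprime m n" by (cases x)
  then have x': "x = of_int m / of_int n" by (simp add: Fract_of_int_quotient)
  have "3 dvd n" using assms x' integral3I by blast
  then obtain n' where n': "n = 3 * n'" by auto
  have "\<not> 3 dvd m" using \<open>3 dvd n\<close> x(3) by (metis coprime_common_divisor not_prime_unit prime3)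
  then have "of_int n' / of_int m \<in> integral3" by (rule integral3I)
  then show ?thesis by (simp add: cong3_def x' n')
qed

text \<open>The four points of the projective line over the field with three elements.\<close>

lemma residue3_cases:
  obtains "x \<notin> integral3" | "x \<approx> 0" | "x \<approx> 1" | "x \<approx> -1"
proof (cases "x \<in> integral3")
  case True
  then obtain m n where e: "x = of_int m / of_int n" "\<not> 3 dvd n"
    by (auto simp: integral3_def)
  have n0: "(of_int n :: rat) \<noteq> 0" using e by auto
  have *: "x \<approx> of_int r" if d: "3 dvd (m - r * n)" for r
  proof -
    obtain q where q: "m - r * n = 3 * q" using d by auto
    have "x - of_int r = of_int (m - r * n) / of_int n" using n0 unfolding e by (simp add: field_simps)
    then have "(x - of_int r) / 3 = of_int q / of_int n" by (simp add: q)
    then show ?thesis using integral3I[OF e(2)] by (simp add: cong3_def)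
  qed
  have "3 dvd (m - 0 * n) \<or> 3 dvd (m - 1 * n) \<or> 3 dvd (m - (-1) * n)" using e(2) by presburger
  then show thesis using that(2-4) *[of 0] *[of 1] *[of "-1"] by auto
qed (use that in blast)

lemma nat_shift: "(t::nat) + 1 + 1 = t + 2" "t + 2 + 1 = t + 3" "t + 3 + 1 = t + 4" "t + 4 + 1 = t + 5"
  "t + 3 + 2 = t + 5"
  by simp_all

text \<open>Modulo 3, \<open>y = 1 / (1 + x)\<close>. Its orbit is \<open>\<infinity> \<mapsto> 0 \<mapsto> 1 \<mapsto> -1 \<mapsto> \<infinity>\<close>.\<close>

lemma mobius_step:
  assumes e: "y * (u * x + v) \<approx> 1" and u: "u \<approx> 1" and v: "v \<approx> 1"
  shows "x \<notin> integral3 \<Longrightarrow> y \<approx> 0" "x \<approx> 0 \<Longrightarrow> y \<approx> 1"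
    "x \<approx> 1 \<Longrightarrow> y \<approx> -1" "x \<approx> -1 \<Longrightarrow> y \<notin> integral3"
proof -
  have nz: "u * x + v \<noteq> 0" using e not_cong3 by auto
  show "y \<approx> 0" if x: "x \<notin> integral3"
  proof -
    have n: "u * x + v \<notin> integral3"
    proof
      assume "u * x + v \<in> integral3"
      then have "u * x + v - v \<in> integral3" using integral3_diff[of "u * x + v" v] cong3_integral[OF v] by simp
      moreover have "1 / u \<in> integral3" using cong3_integral[OF cong3_inverse[OF u]] by simp
      ultimately have "(u * x + v - v) * (1 / u) \<in> integral3" by (rule integral3_mult)
      moreover have "u \<noteq> 0" using u not_cong3 by auto
      ultimately show False using x by simp
    qed
    show ?thesis using cong3_mult[OF e not_integral3_inverse[OF n]] nz by simp
  qed
  show "y \<approx> 1" if x: "x \<approx> 0"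
  proof -
    have n: "u * x + v \<approx> 1" using cong3_add[OF cong3_mult[OF u x] v] by simp
    show ?thesis using cong3_divide(1)[OF e n] nz by simp
  qed
  show "y \<approx> -1" if x: "x \<approx> 1"
  proof -
    have "u * x + v \<approx> 2" using cong3_add[OF cong3_mult[OF u x] v] by simp
    also have "2 \<approx> -1" by (simp add: cong3_def)
    finally have n: "u * x + v \<approx> -1" .
    show ?thesis using cong3_divide(1)[OF e n] nz by simp
  qed
  show "y \<notin> integral3" if x: "x \<approx> -1"
  proof
    assume "y \<in> integral3"
    moreover have "u * x + v \<approx> 0" using cong3_add[OF cong3_mult[OF u x] v] by simp
    ultimately have "y * (u * x + v) \<approx> 0" using cong3_mult[OF cong3_refl, of "u * x + v" 0 y] by simp
    then show False using e cong3_sym cong3_trans not_cong3 by blast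
  qed
qed

text \<open>The orbit has length four, so five steps move every point.\<close>

lemma no_mobius_5cycle:
  fixes e :: "nat \<Rightarrow> rat"
  assumes "\<And>t. \<exists>u v. u \<approx> 1 \<and> v \<approx> 1 \<and> e (t + 1) * (u * e t + v) \<approx> 1" and "e 5 = e 0"
  shows False
proof -
  have step: "e t \<notin> integral3 \<Longrightarrow> e (t + 1) \<approx> 0" "e t \<approx> 0 \<Longrightarrow> e (t + 1) \<approx> 1"
    "e t \<approx> 1 \<Longrightarrow> e (t + 1) \<approx> -1" "e t \<approx> -1 \<Longrightarrow> e (t + 1) \<notin> integral3" for t
    using assms(1)[of t] mobius_step by blast+
  have five: "e t \<notin> integral3 \<Longrightarrow> e (t + 5) \<approx> 0" "e t \<approx> 0 \<Longrightarrow> e (t + 5) \<approx> 1"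
    "e t \<approx> 1 \<Longrightarrow> e (t + 5) \<approx> -1" "e t \<approx> -1 \<Longrightarrow> e (t + 5) \<notin> integral3" for t
    using step[of t] step[of "t + 1"] step[of "t + 2"] step[of "t + 3"] step[of "t + 4"]
    unfolding nat_shift by blast+
  have five0: "e 0 \<notin> integral3 \<Longrightarrow> e 0 \<approx> 0" "e 0 \<approx> 0 \<Longrightarrow> e 0 \<approx> 1"
    "e 0 \<approx> 1 \<Longrightarrow> e 0 \<approx> -1" "e 0 \<approx> -1 \<Longrightarrow> e 0 \<notin> integral3"
    using five[of 0] assms(2) by simp_all
  have "x \<in> integral3" if "x \<approx> 0 \<or> x \<approx> -1" for x
    using that cong3_integral[of x] by auto
  then show False
    using five0 not_cong3 by (cases "e 0" rule: residue3_cases) (meson cong3_sym cong3_trans)+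
qed

section \<open>Cycles of exchanges\<close>

text \<open>The algebra behind a hypothetical 10-cycle in two layers. The functional on the vectors attached
to the indices is represented by its values, so \<open>L\<close> is the row space of the matrix with these
vectors as columns. The set \<open>A t\<close> loses \<open>b t\<close> and gains \<open>a t\<close>; the indices are taken modulo 5,
expressed by periodicity so that the situation can be rotated. The assumptions \<open>phi_a\<close> and \<open>phi_b\<close>
say that the edges from \<open>A t\<close> and from \<open>A (t + 1)\<close> up to their union are kept. The assumptions
turn out to be contradictory.\<close>

locale exchange_cycle =
  fixes L :: "('x \<Rightarrow> rat) set" and w :: 'x
    and A :: "nat \<Rightarrow> 'x set" and a b :: "nat \<Rightarrow> 'x" and \<phi> :: "nat \<Rightarrow> 'x \<Rightarrow> rat"
  assumes L_lin: "\<And>f g c. f \<in> L \<Longrightarrow> g \<in> L \<Longrightarrow> (\<lambda>x. f x + c * g x) \<in> L"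
    and A_per: "\<And>t. A (t + 5) = A t" and a_per: "\<And>t. a (t + 5) = a t"
    and b_per: "\<And>t. b (t + 5) = b t" and phi_per: "\<And>t. \<phi> (t + 5) = \<phi> t"
    and a_notin: "\<And>t. a t \<notin> A t" and b_in: "\<And>t. b t \<in> A t"
    and A_step: "\<And>t. A (t + 1) = insert (a t) (A t) - {b t}"
    and b_neq: "\<And>t. b t \<noteq> a (t + 1)"
    and phi_L: "\<And>t. \<phi> t \<in> L" and phi_w: "\<And>t. \<phi> t w = 1"
    and phi_A: "\<And>t x. x \<in> A t \<Longrightarrow> \<phi> t x = 0"
    and phi_a: "\<And>t. \<phi> t (a t) \<approx> 1" and phi_b: "\<And>t. \<phi> (t + 1) (b t) \<approx> 1"
    and L_unique: "\<And>f t x. f \<in> L \<Longrightarrow> f w = 0 \<Longrightarrow> (\<forall>x\<in>A t. f x = 0) \<Longrightarrow> f x = 0"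
begin

lemma exchange_cycle_shift:
  "exchange_cycle L w (\<lambda>t. A (r + t)) (\<lambda>t. a (r + t)) (\<lambda>t. b (r + t)) (\<lambda>t. \<phi> (r + t))"
  by unfold_locales
    (unfold add.assoc[symmetric], (fact L_lin A_per a_per b_per phi_per a_notin b_in A_step b_neq
      phi_L phi_w phi_A phi_a phi_b L_unique)+)

lemma mem1: "x \<in> A (t + 1) \<longleftrightarrow> (x = a t \<or> x \<in> A t) \<and> x \<noteq> b t"
  using A_step by auto

lemma b_neq_a: "b t \<noteq> a t"
  using a_notin b_in by metis

lemma b_neq': "b (t + 4) \<noteq> a t"
  using b_neq[of "t + 4"] unfolding nat_shift a_per .

lemma mem2: "x \<in> A (t + 2) \<longleftrightarrow> (x = a (t + 1) \<or> x \<in> A (t + 1)) \<and> x \<noteq> b (t + 1)"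
  using mem1[of x "t + 1"] unfolding nat_shift .

lemma mem3: "x \<in> A (t + 3) \<longleftrightarrow> (x = a (t + 2) \<or> x \<in> A (t + 2)) \<and> x \<noteq> b (t + 2)"
  using mem1[of x "t + 2"] unfolding nat_shift .

lemma mem4: "x \<in> A (t + 4) \<longleftrightarrow> (x = a (t + 3) \<or> x \<in> A (t + 3)) \<and> x \<noteq> b (t + 3)"
  using mem1[of x "t + 3"] unfolding nat_shift .

lemma mem5: "x \<in> A t \<longleftrightarrow> (x = a (t + 4) \<or> x \<in> A (t + 4)) \<and> x \<noteq> b (t + 4)"
  using mem1[of x "t + 4"] unfolding nat_shift A_per .

lemma a_distinct1: "a t \<noteq> a (t + 1)"
  using mem1[of "a t" t] b_neq_a[of t] a_notin[of "t + 1"] by metis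

lemma a_distinct2: "a t \<noteq> a (t + 2)"
proof
  assume e: "a t = a (t + 2)"
  have "b (t + 1) \<noteq> a (t + 2)" using b_neq[of "t + 1"] unfolding nat_shift .
  then have "a t \<in> A (t + 2)"
    using e mem1[of "a t" t] mem2[of "a t" t] b_neq_a[of t] by metis
  then show False using e a_notin[of "t + 2"] by simp
qed

lemma a_distinct3: "a t \<noteq> a (t + 3)" "a t \<noteq> a (t + 4)"
  using a_distinct1[of "t + 4"] a_distinct2[of "t + 3"] unfolding nat_shift a_per by simp_all

lemmas a_distinct = a_distinct1 a_distinct2 a_distinct3

text \<open>The element \<open>a t\<close> has to leave again within the cycle. It cannot do so immediately, since
\<open>b t\<close> differs from \<open>a t\<close>, nor just before it is added again, since \<open>b (t + 4)\<close> differs from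
\<open>a (t + 5)\<close>.\<close>

lemma a_removed: "b (t + 1) = a t \<or> b (t + 2) = a t \<or> b (t + 3) = a t"
  using mem1[of "a t" t] mem2[of "a t" t] mem3[of "a t" t] mem4[of "a t" t] mem5[of "a t" t]
    a_notin[of t] b_neq_a[of t] b_neq'[of t] a_distinct[of t] by argo

lemma mem_after:
  shows "a t \<in> A (t + 1)" "a t \<in> A (t + 2) \<longleftrightarrow> b (t + 1) \<noteq> a t"
    "a t \<in> A (t + 3) \<longleftrightarrow> b (t + 1) \<noteq> a t \<and> b (t + 2) \<noteq> a t"
    "a t \<in> A (t + 4) \<longleftrightarrow> b (t + 1) \<noteq> a t \<and> b (t + 2) \<noteq> a t \<and> b (t + 3) \<noteq> a t"
  using mem1[of "a t" t] mem2[of "a t" t] mem3[of "a t" t] mem4[of "a t" t]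
    b_neq_a[of t] a_distinct[of t] by auto

text \<open>Differences are easier to handle than the functionals \<open>\<phi> t\<close>: they all lie in the linear space
\<open>H\<close> below, and they have sum zero around the cycle.\<close>

definition h :: "nat \<Rightarrow> 'x \<Rightarrow> rat" where
  "h t x = \<phi> t x - \<phi> (t + 1) x"

lemma h_a: "h t (a t) \<approx> 1"
  using phi_a[of t] phi_A[OF mem_after(1)[of t]] by (simp add: h_def)

lemma h_b: "h t (b t) \<approx> -1"
  using cong3_uminus[OF phi_b[of t]] phi_A[OF b_in[of t]] by (simp add: h_def)

lemma h_zero: "x \<in> A t \<Longrightarrow> x \<in> A (t + 1) \<Longrightarrow> h t x = 0"
  by (simp add: h_def phi_A)

lemma h_sum: "h t x + h (t + 1) x + h (t + 2) x + h (t + 3) x + h (t + 4) x = 0"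
  unfolding h_def nat_shift phi_per by simp

text \<open>The indices that are never moved, and belong to every \<open>A t\<close>.\<close>

definition S :: "'x set" where
  "S = A 0 - range a"

definition H :: "('x \<Rightarrow> rat) set" where
  "H = {f \<in> L. f w = 0 \<and> (\<forall>x\<in>S. f x = 0)}"

lemma range_b: "b t \<in> range a"
proof (rule ccontr)
  assume "b t \<notin> range a"
  then have n: "b t \<noteq> a s" for s by auto
  have "b t \<notin> A (t + 1)" using mem1 by simp
  then have "b t \<notin> A (t + 5)"
    using n mem2[of "b t" t] mem3[of "b t" t] mem4[of "b t" t] mem5[of "b t" t]
    unfolding A_per by simp
  then show False using b_in A_per by metis
qed

lemma S_eq: "A t - range a = S"
proof (induction t)
  case (Suc t)
  have "A (Suc t) - range a = A t - range a"
    using A_step[of t] range_b[of t] by auto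
  then show ?case using Suc by simp
qed (simp add: S_def)

lemma range_a: "range a = {a 0, a 1, a 2, a 3, a 4}"
proof -
  have *: "a s = a (s mod 5)" for s
  proof (induction s rule: less_induct)
    case (less s)
    show ?case
    proof (cases "s < 5")
      case False
      then have "a s = a (s - 5)" using a_per[of "s - 5"] by simp
      also have "\<dots> = a ((s - 5) mod 5)" using less[of "s - 5"] False by simp
      also have "(s - 5) mod 5 = s mod 5" using False by (metis le_mod_geq not_less)
      finally show ?thesis .
    qed simp
  qed
  have "a s \<in> {a 0, a 1, a 2, a 3, a 4}" for s
  proof -
    have "s mod 5 < 5" by simp
    then have "s mod 5 = 0 \<or> s mod 5 = 1 \<or> s mod 5 = 2 \<or> s mod 5 = 3 \<or> s mod 5 = 4" by linarith
    then show ?thesis using *[of s] by (elim disjE) simp_all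
  qed
  then show ?thesis by auto
qed

lemma h_H: "h t \<in> H"
proof -
  have "(\<lambda>x. \<phi> t x + (-1) * \<phi> (t + 1) x) \<in> L" by (intro L_lin phi_L)
  moreover have "(\<lambda>x. \<phi> t x + (-1) * \<phi> (t + 1) x) = h t" by (auto simp: h_def)
  moreover have "h t x = 0" if "x \<in> S" for x
    using that S_eq[of t] S_eq[of "t + 1"] by (intro h_zero) auto
  ultimately show ?thesis by (simp add: H_def h_def phi_w)
qed

lemma H_lin: "f \<in> H \<Longrightarrow> g \<in> H \<Longrightarrow> (\<lambda>x. f x - c * g x) \<in> H"
  using L_lin[of f g "-c"] by (simp add: H_def)

text \<open>The source of all linear relations: an element of \<open>H\<close> is determined by its values at the moved
elements of a single \<open>A t\<close>.\<close>

lemma H_unique: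
  assumes "f \<in> H" and "\<And>x. x \<in> A t \<Longrightarrow> x \<in> range a \<Longrightarrow> f x = 0"
  shows "f x = 0"
proof (rule L_unique)
  show "\<forall>x\<in>A t. f x = 0" using assms S_eq[of t] by (auto simp: H_def)
qed (use assms in \<open>auto simp: H_def\<close>)

lemma per0: "A 5 = A 0" "A 6 = A 1" "A 7 = A 2" "A 8 = A 3"
  "a 5 = a 0" "a 6 = a 1" "a 7 = a 2" "a 8 = a 3"
  "b 5 = b 0" "b 6 = b 1" "b 7 = b 2" "b 8 = b 3"
  using A_per[of 0] A_per[of 1] A_per[of 2] A_per[of 3] a_per[of 0] a_per[of 1] a_per[of 2] a_per[of 3]
    b_per[of 0] b_per[of 1] b_per[of 2] b_per[of 3] by simp_all

lemma h_sum0: "h 0 x + h 1 x + h 2 x + h 3 x + h 4 x = 0"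
  using h_sum[of 0 x] by (simp add: eval_nat_numeral)

lemma distinct0: "distinct [a 0, a 1, a 2, a 3, a 4]"
  using a_distinct[of 0] a_distinct[of 1] a_distinct[of 2] a_distinct[of 3] per0
  by (simp add: eval_nat_numeral)

lemma mem0:
  "a 0 \<in> A 1" "a 0 \<in> A 2 \<longleftrightarrow> b 1 \<noteq> a 0" "a 0 \<in> A 3 \<longleftrightarrow> b 1 \<noteq> a 0 \<and> b 2 \<noteq> a 0"
  "a 0 \<in> A 4 \<longleftrightarrow> b 1 \<noteq> a 0 \<and> b 2 \<noteq> a 0 \<and> b 3 \<noteq> a 0" "a 0 \<notin> A 0"
  "a 1 \<in> A 2" "a 1 \<in> A 3 \<longleftrightarrow> b 2 \<noteq> a 1" "a 1 \<in> A 4 \<longleftrightarrow> b 2 \<noteq> a 1 \<and> b 3 \<noteq> a 1"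
  "a 1 \<in> A 0 \<longleftrightarrow> b 2 \<noteq> a 1 \<and> b 3 \<noteq> a 1 \<and> b 4 \<noteq> a 1" "a 1 \<notin> A 1"
  "a 2 \<in> A 3" "a 2 \<in> A 4 \<longleftrightarrow> b 3 \<noteq> a 2" "a 2 \<in> A 0 \<longleftrightarrow> b 3 \<noteq> a 2 \<and> b 4 \<noteq> a 2"
  "a 2 \<in> A 1 \<longleftrightarrow> b 3 \<noteq> a 2 \<and> b 4 \<noteq> a 2 \<and> b 0 \<noteq> a 2" "a 2 \<notin> A 2"
  "a 3 \<in> A 4" "a 3 \<in> A 0 \<longleftrightarrow> b 4 \<noteq> a 3" "a 3 \<in> A 1 \<longleftrightarrow> b 4 \<noteq> a 3 \<and> b 0 \<noteq> a 3"
  "a 3 \<in> A 2 \<longleftrightarrow> b 4 \<noteq> a 3 \<and> b 0 \<noteq> a 3 \<and> b 1 \<noteq> a 3" "a 3 \<notin> A 3"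
  "a 4 \<in> A 0" "a 4 \<in> A 1 \<longleftrightarrow> b 0 \<noteq> a 4" "a 4 \<in> A 2 \<longleftrightarrow> b 0 \<noteq> a 4 \<and> b 1 \<noteq> a 4"
  "a 4 \<in> A 3 \<longleftrightarrow> b 0 \<noteq> a 4 \<and> b 1 \<noteq> a 4 \<and> b 2 \<noteq> a 4" "a 4 \<notin> A 4"
  using mem_after[of 0] mem_after[of 1] mem_after[of 2] mem_after[of 3] mem_after[of 4]
    a_notin[of 0] a_notin[of 1] a_notin[of 2] a_notin[of 3] a_notin[of 4] per0
  by (simp_all add: eval_nat_numeral)

lemma h_zero0:
  "x \<in> A 0 \<Longrightarrow> x \<in> A 1 \<Longrightarrow> h 0 x = 0" "x \<in> A 1 \<Longrightarrow> x \<in> A 2 \<Longrightarrow> h 1 x = 0"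
  "x \<in> A 2 \<Longrightarrow> x \<in> A 3 \<Longrightarrow> h 2 x = 0" "x \<in> A 3 \<Longrightarrow> x \<in> A 4 \<Longrightarrow> h 3 x = 0"
  "x \<in> A 4 \<Longrightarrow> x \<in> A 0 \<Longrightarrow> h 4 x = 0"
  using h_zero[of x 0] h_zero[of x 1] h_zero[of x 2] h_zero[of x 3] h_zero[of x 4] per0
  by (simp_all add: eval_nat_numeral)

lemma removed0:
  "b 1 = a 0 \<or> b 2 = a 0 \<or> b 3 = a 0" "b 2 = a 1 \<or> b 3 = a 1 \<or> b 4 = a 1"
  "b 3 = a 2 \<or> b 4 = a 2 \<or> b 0 = a 2" "b 4 = a 3 \<or> b 0 = a 3 \<or> b 1 = a 3"
  "b 0 = a 4 \<or> b 1 = a 4 \<or> b 2 = a 4"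
  using a_removed[of 0] a_removed[of 1] a_removed[of 2] a_removed[of 3] a_removed[of 4] per0
  by (simp_all add: eval_nat_numeral)

lemma H_unique0:
  assumes "f \<in> H" "\<And>x. x \<in> {a 0, a 1, a 2, a 3, a 4} \<Longrightarrow> x \<in> A t \<Longrightarrow> f x = 0"
  shows "f x = 0"
  using H_unique[OF assms(1), of t] assms(2) range_a by blast

declare One_nat_def [simp del] add_2_eq_Suc [simp del] add_2_eq_Suc' [simp del]

section \<open>The five exchange patterns\<close>

text \<open>Here each \<open>A t\<close> contains two of the five moved elements, and as edges on these elements the five
pairs form a bull, a triangle with two pendant edges at different vertices. Both \<open>h 0\<close> and \<open>h 4\<close>
vanish at \<open>a 3\<close>, so they are proportional, with factor \<open>-1\<close> modulo 3 according to \<open>a 4\<close>. At \<open>a 1\<close> the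
sum of the \<open>h t\<close> is then \<open>1 + 1 - 1\<close> modulo 3.\<close>

lemma no_bull:
  assumes b: "b 0 = a 4" "b 1 = a 3" "b 2 = a 0" "b 3 = a 2" "b 4 = a 1"
  shows False
proof -
  have h0: "h 0 (a 4) \<approx> -1" "h 0 (a 3) = 0"
    using h_b[of 0] b distinct0 by (auto simp: mem0 intro!: h_zero0)
  have h1: "h 1 (a 1) \<approx> 1" by (rule h_a)
  have h2: "h 2 (a 1) = 0" and h3: "h 3 (a 1) = 0"
    using b distinct0 by (auto simp: mem0 intro!: h_zero0)
  have h4: "h 4 (a 4) \<approx> 1" "h 4 (a 1) \<approx> -1" "h 4 (a 3) = 0"
    using h_a[of 4] h_b[of 4] b distinct0 by (auto simp: mem0 intro!: h_zero0)
  define k where "k = h 4 (a 4) / h 0 (a 4)"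
  have k: "k \<approx> -1" and n0: "h 0 (a 4) \<noteq> 0"
    using cong3_divide[OF h4(1) h0(1)] by (auto simp: k_def)
  have "h 4 x - k * h 0 x = 0" for x
  proof (rule H_unique0[where t = 0])
    show "(\<lambda>x. h 4 x - k * h 0 x) \<in> H" by (intro H_lin h_H)
    fix x assume "x \<in> {a 0, a 1, a 2, a 3, a 4}" "x \<in> A 0"
    then have "x = a 3 \<or> x = a 4" using b distinct0 by (auto simp: mem0)
    then show "h 4 x - k * h 0 x = 0" using h0 h4 n0 by (auto simp: k_def)
  qed
  then have e: "h 4 (a 1) = k * h 0 (a 1)" by simp
  have "k \<noteq> 0" using k not_cong3 by auto
  then have "h 0 (a 1) = h 4 (a 1) / k" using e by simp
  then have "h 0 (a 1) \<approx> 1" using cong3_divide(1)[OF h4(2) k] by simp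
  then have "h 0 (a 1) + h 1 (a 1) + h 4 (a 1) \<approx> 1 + 1 + -1"
    by (intro cong3_add h1 h4)
  then show False using h_sum0[of "a 1"] h2 h3 not_cong3 by simp
qed

text \<open>The five pairs form a 4-cycle with a pendant edge. Vanishing at \<open>a 4\<close> makes \<open>h 0\<close> and \<open>h 1\<close>
proportional with factor \<open>-1\<close>. The sums at \<open>a 3\<close> and \<open>a 4\<close> then determine the missing residues
that are needed to write \<open>h 3\<close> as a combination of \<open>h 0\<close> and \<open>h 2\<close>, which has the wrong sign at
\<open>a 3\<close>.\<close>

lemma no_square_with_tail:
  assumes b: "b 0 = a 3" "b 1 = a 0" "b 2 = a 4" "b 3 = a 1" "b 4 = a 2"
  shows False
proof -
  have h0: "h 0 (a 0) \<approx> 1" "h 0 (a 3) \<approx> -1" "h 0 (a 4) = 0"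
    using h_a[of 0] h_b[of 0] b distinct0 by (auto simp: mem0 intro!: h_zero0)
  have h1: "h 1 (a 1) \<approx> 1" "h 1 (a 0) \<approx> -1" "h 1 (a 4) = 0"
    using h_a[of 1] h_b[of 1] b distinct0 by (auto simp: mem0 intro!: h_zero0)
  have h2: "h 2 (a 2) \<approx> 1" "h 2 (a 4) \<approx> -1" "h 2 (a 1) = 0"
    using h_a[of 2] h_b[of 2] b distinct0 by (auto simp: mem0 intro!: h_zero0)
  have h3: "h 3 (a 3) \<approx> 1" "h 3 (a 1) \<approx> -1"
    using h_a[of 3] h_b[of 3] b by auto
  have h4: "h 4 (a 4) \<approx> 1" "h 4 (a 3) = 0"
    using h_a[of 4] b distinct0 by (auto simp: mem0 intro!: h_zero0)
  define k where "k = h 1 (a 0) / h 0 (a 0)"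
  have k: "k \<approx> -1" and n0: "h 0 (a 0) \<noteq> 0"
    using cong3_divide[OF h1(2) h0(1)] by (auto simp: k_def)
  have "h 1 x - k * h 0 x = 0" for x
  proof (rule H_unique0[where t = 1])
    show "(\<lambda>x. h 1 x - k * h 0 x) \<in> H" by (intro H_lin h_H)
    fix x assume "x \<in> {a 0, a 1, a 2, a 3, a 4}" "x \<in> A 1"
    then have "x = a 0 \<or> x = a 4" using b distinct0 by (auto simp: mem0)
    then show "h 1 x - k * h 0 x = 0" using h0 h1 n0 by (auto simp: k_def)
  qed
  then have e: "h 1 x = k * h 0 x" for x by simp
  have "k \<noteq> 0" using k not_cong3 by auto
  then have "h 0 (a 1) = h 1 (a 1) / k" using e by simp
  then have h0': "h 0 (a 1) \<approx> -1" using cong3_divide(1)[OF h1(1) k] by simp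
  have h1': "h 1 (a 3) \<approx> 1" using cong3_mult[OF k h0(2)] e by simp
  have "- (h 0 (a 3) + h 1 (a 3) + h 3 (a 3)) \<approx> - (-1 + 1 + 1)"
    by (intro cong3_add cong3_uminus h0 h1' h3)
  moreover have "h 2 (a 3) = - (h 0 (a 3) + h 1 (a 3) + h 3 (a 3))"
    using h_sum0[of "a 3"] h4 by (simp add: algebra_simps)
  ultimately have h2': "h 2 (a 3) \<approx> -1" by simp
  have "- (h 2 (a 4) + h 4 (a 4)) \<approx> - (-1 + 1)"
    by (intro cong3_add cong3_uminus h2 h4)
  moreover have "h 3 (a 4) = - (h 2 (a 4) + h 4 (a 4))"
    using h_sum0[of "a 4"] h0 h1 by (simp add: algebra_simps)
  ultimately have h3': "h 3 (a 4) \<approx> 0" by simp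
  define p where "p = h 3 (a 1) / h 0 (a 1)"
  define q where "q = h 3 (a 4) / h 2 (a 4)"
  have p: "p \<approx> 1" and n1: "h 0 (a 1) \<noteq> 0"
    using cong3_divide[OF h3(2) h0'] by (auto simp: p_def)
  have q: "q \<approx> 0" and n2: "h 2 (a 4) \<noteq> 0"
    using cong3_divide[OF h3' h2(2)] by (auto simp: q_def)
  have "h 3 x - p * h 0 x - q * h 2 x = 0" for x
  proof (rule H_unique0[where t = 2])
    show "(\<lambda>x. h 3 x - p * h 0 x - q * h 2 x) \<in> H" by (intro H_lin h_H)
    fix x assume "x \<in> {a 0, a 1, a 2, a 3, a 4}" "x \<in> A 2"
    then have "x = a 1 \<or> x = a 4" using b distinct0 by (auto simp: mem0)
    then show "h 3 x - p * h 0 x - q * h 2 x = 0" using h0 h2 n1 n2 by (auto simp: p_def q_def)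
  qed
  then have "h 3 (a 3) = p * h 0 (a 3) + q * h 2 (a 3)" by (simp add: algebra_simps)
  also have "\<dots> \<approx> 1 * -1 + 0 * -1"
    by (intro cong3_add cong3_mult p q h0 h2') simp_all
  finally have "h 3 (a 3) \<approx> -1" by simp
  then show False using h3(1) cong3_sym cong3_trans not_cong3 by blast
qed

text \<open>Each \<open>A t\<close> contains one moved element, so \<open>H\<close> is at most one-dimensional. Along the cycle,
the values of a fixed nonzero element of \<open>H\<close> at successive moved elements change sign modulo 3,
which is impossible as the cycle is odd.\<close>

lemma no_singletons:
  assumes b: "b 0 = a 4" "b 1 = a 0" "b 2 = a 1" "b 3 = a 2" "b 4 = a 3"
  shows False
proof -
  have step: "f x \<approx> - s"
    if f: "f \<in> H" "f y \<approx> s" "s = 1 \<or> s = -1"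
      and t: "h t x \<approx> 1" "h t y \<approx> -1" "\<And>z. z \<in> {a 0, a 1, a 2, a 3, a 4} \<Longrightarrow> z \<in> A t \<Longrightarrow> z = y"
    for f s t x y
  proof -
    define k where "k = f y / h t y"
    have k: "k \<approx> - s" and n: "h t y \<noteq> 0"
      using cong3_divide[OF f(2) t(2)] f(3) by (auto simp: k_def)
    have "f x - k * h t x = 0" for x
    proof (rule H_unique0[where t = t])
      show "(\<lambda>x. f x - k * h t x) \<in> H" by (intro H_lin h_H f)
      fix x assume "x \<in> {a 0, a 1, a 2, a 3, a 4}" "x \<in> A t"
      then have "x = y" using t(3) by blast
      then show "f x - k * h t x = 0" using n by (auto simp: k_def)
    qed
    then have "f x = k * h t x" by simp
    then show ?thesis using cong3_mult[OF k t(1)] f(3) by auto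
  qed
  have A: "z \<in> A 1 \<Longrightarrow> z = a 0" "z \<in> A 2 \<Longrightarrow> z = a 1" "z \<in> A 3 \<Longrightarrow> z = a 2" "z \<in> A 4 \<Longrightarrow> z = a 3"
    if "z \<in> {a 0, a 1, a 2, a 3, a 4}" for z
    using that b distinct0 by (auto simp: mem0)
  have hb: "h 1 (a 0) \<approx> -1" "h 2 (a 1) \<approx> -1" "h 3 (a 2) \<approx> -1" "h 4 (a 3) \<approx> -1"
    using h_b[of 1] h_b[of 2] h_b[of 3] h_b[of 4] b by simp_all
  have s0: "h 0 (a 0) \<approx> 1" by (rule h_a)
  have s1: "h 0 (a 1) \<approx> -1"
    using step[OF h_H s0 _ h_a hb(1) A(1)] by simp
  have s2: "h 0 (a 2) \<approx> 1"
    using step[OF h_H s1 _ h_a hb(2) A(2)] by simp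
  have s3: "h 0 (a 3) \<approx> -1"
    using step[OF h_H s2 _ h_a hb(3) A(3)] by simp
  have "h 0 (a 4) \<approx> 1"
    using step[OF h_H s3 _ h_a hb(4) A(4)] by simp
  moreover have "h 0 (a 4) \<approx> -1" using h_b[of 0] b by simp
  ultimately show False using cong3_sym cong3_trans not_cong3 by blast
qed

text \<open>Each \<open>A t\<close> contains three moved elements. The sums at \<open>a 1\<close>, \<open>a 2\<close> and \<open>a 4\<close> show that the
one unspecified value of each of \<open>h 0\<close>, \<open>h 1\<close> and \<open>h 3\<close> is divisible by 3. Hence the \<open>h t\<close> are,
modulo 3, the differences along a 5-cycle and span a space of dimension four, whereas \<open>H\<close> has
dimension at most three.\<close>

lemma no_triples:
  assumes b: "b 0 = a 2" "b 1 = a 3" "b 2 = a 4" "b 3 = a 0" "b 4 = a 1"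
  shows False
proof -
  have h0: "h 0 (a 0) \<approx> 1" "h 0 (a 2) \<approx> -1" "h 0 (a 3) = 0" "h 0 (a 4) = 0"
    using h_a[of 0] h_b[of 0] b distinct0 by (auto simp: mem0 intro!: h_zero0)
  have h1: "h 1 (a 1) \<approx> 1" "h 1 (a 3) \<approx> -1" "h 1 (a 4) = 0" "h 1 (a 0) = 0"
    using h_a[of 1] h_b[of 1] b distinct0 by (auto simp: mem0 intro!: h_zero0)
  have h2: "h 2 (a 2) \<approx> 1" "h 2 (a 4) \<approx> -1" "h 2 (a 0) = 0" "h 2 (a 1) = 0"
    using h_a[of 2] h_b[of 2] b distinct0 by (auto simp: mem0 intro!: h_zero0)
  have h3: "h 3 (a 3) \<approx> 1" "h 3 (a 0) \<approx> -1" "h 3 (a 1) = 0" "h 3 (a 2) = 0"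
    using h_a[of 3] h_b[of 3] b distinct0 by (auto simp: mem0 intro!: h_zero0)
  have h4: "h 4 (a 4) \<approx> 1" "h 4 (a 1) \<approx> -1" "h 4 (a 2) = 0" "h 4 (a 3) = 0"
    using h_a[of 4] h_b[of 4] b distinct0 by (auto simp: mem0 intro!: h_zero0)
  have "h 0 (a 1) = - (h 1 (a 1) + h 4 (a 1))"
    using h_sum0[of "a 1"] h2 h3 by (simp add: algebra_simps)
  then have h0': "h 0 (a 1) \<approx> 0"
    using cong3_uminus[OF cong3_add[OF h1(1) h4(2)]] by simp
  have "h 1 (a 2) = - (h 0 (a 2) + h 2 (a 2))"
    using h_sum0[of "a 2"] h3 h4 by (simp add: algebra_simps)
  then have h1': "h 1 (a 2) \<approx> 0"
    using cong3_uminus[OF cong3_add[OF h0(2) h2(1)]] by simp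
  have "h 3 (a 4) = - (h 2 (a 4) + h 4 (a 4))"
    using h_sum0[of "a 4"] h0 h1 by (simp add: algebra_simps)
  then have h3': "h 3 (a 4) \<approx> 0"
    using cong3_uminus[OF cong3_add[OF h2(2) h4(1)]] by simp
  define p where "p = h 3 (a 0) / h 0 (a 0)"
  define q where "q = - p * h 0 (a 1) / h 1 (a 1)"
  define r where "r = (- p * h 0 (a 2) - q * h 1 (a 2)) / h 2 (a 2)"
  have p: "p \<approx> -1" and n0: "h 0 (a 0) \<noteq> 0"
    using cong3_divide[OF h3(2) h0(1)] by (auto simp: p_def)
  have q0: "- p * h 0 (a 1) \<approx> 0"
    using cong3_mult[OF cong3_uminus[OF p] h0'] by simp
  have q: "q \<approx> 0" and n1: "h 1 (a 1) \<noteq> 0"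
    using cong3_divide[OF q0 h1(1)] by (simp_all add: q_def)
  have r0: "- p * h 0 (a 2) - q * h 1 (a 2) \<approx> -1"
    using cong3_diff[OF cong3_mult[OF cong3_uminus[OF p] h0(2)] cong3_mult[OF q h1']] by simp
  have r: "r \<approx> -1" and n2: "h 2 (a 2) \<noteq> 0"
    using cong3_divide[OF r0 h2(1)] by (simp_all add: r_def)
  have "h 3 x - p * h 0 x - q * h 1 x - r * h 2 x = 0" for x
  proof (rule H_unique0[where t = 3])
    show "(\<lambda>x. h 3 x - p * h 0 x - q * h 1 x - r * h 2 x) \<in> H" by (intro H_lin h_H)
    fix x assume "x \<in> {a 0, a 1, a 2, a 3, a 4}" "x \<in> A 3"
    then have "x = a 0 \<or> x = a 1 \<or> x = a 2" using b distinct0 by (auto simp: mem0)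
    then show "h 3 x - p * h 0 x - q * h 1 x - r * h 2 x = 0"
      using h1 h2 h3 n0 n1 n2 by (auto simp: p_def q_def r_def)
  qed
  from this[of "a 4"] have "h 3 (a 4) = r * h 2 (a 4)" using h0 h1 by simp
  then have "h 3 (a 4) \<approx> 1" using cong3_mult[OF r h2(2)] by simp
  then show False using h3' cong3_sym cong3_trans not_cong3 by blast
qed

text \<open>Here the five pairs form a pentagon. The functional \<open>h 2\<close> is a combination of \<open>h 0\<close> and \<open>h 1\<close>,
read off at \<open>a 0\<close> and \<open>a 1\<close>. Evaluation at \<open>a 2\<close>, where the sum of the \<open>h t\<close> eliminates
\<open>h 0 (a 2)\<close>, relates \<open>h 1 (a 2)\<close> to \<open>h 0 (a 1)\<close>. Neither number has to be integral at 3, which is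
why the factors \<open>u\<close> and \<open>v\<close> are retained.\<close>

lemma pentagon_step:
  assumes b: "b 0 = a 3" "b 1 = a 4" "b 2 = a 0" "b 3 = a 1" "b 4 = a 2"
  shows "\<exists>u v. u \<approx> 1 \<and> v \<approx> 1 \<and> h 1 (a 2) * (u * h 0 (a 1) + v) \<approx> 1"
proof -
  have h0: "h 0 (a 0) \<approx> 1" by (rule h_a)
  have h1: "h 1 (a 1) \<approx> 1" "h 1 (a 0) = 0"
    using h_a[of 1] b distinct0 by (auto simp: mem0 intro!: h_zero0)
  have h2: "h 2 (a 2) \<approx> 1" "h 2 (a 0) \<approx> -1" "h 2 (a 1) = 0"
    using h_a[of 2] h_b[of 2] b distinct0 by (auto simp: mem0 intro!: h_zero0)
  have h3: "h 3 (a 2) = 0" and h4: "h 4 (a 2) \<approx> -1"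
    using h_b[of 4] b distinct0 by (auto simp: mem0 intro!: h_zero0)
  define i where "i = h 2 (a 2) + h 4 (a 2)"
  have i: "i \<approx> 0" using cong3_add[OF h2(1) h4] by (simp add: i_def)
  have g: "h 0 (a 2) = - h 1 (a 2) - i"
    using h_sum0[of "a 2"] h3 by (simp add: i_def)
  define p where "p = h 2 (a 0) / h 0 (a 0)"
  have p: "p \<approx> -1" and n0: "h 0 (a 0) \<noteq> 0"
    using cong3_divide[OF h2(2) h0] by (simp_all add: p_def)
  have mp: "- p \<approx> 1" using cong3_uminus[OF p] by simp
  define u where "u = - p / h 1 (a 1)"
  have u: "u \<approx> 1" and n1: "h 1 (a 1) \<noteq> 0"
    using cong3_divide[OF mp h1(1)] by (simp_all add: u_def)
  have "h 2 x - p * h 0 x - (u * h 0 (a 1)) * h 1 x = 0" for x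
  proof (rule H_unique0[where t = 2])
    show "(\<lambda>x. h 2 x - p * h 0 x - (u * h 0 (a 1)) * h 1 x) \<in> H" by (intro H_lin h_H)
    fix x assume "x \<in> {a 0, a 1, a 2, a 3, a 4}" "x \<in> A 2"
    then have "x = a 0 \<or> x = a 1" using b distinct0 by (auto simp: mem0)
    then show "h 2 x - p * h 0 x - (u * h 0 (a 1)) * h 1 x = 0"
      using h1 h2 n0 n1 by (auto simp: p_def u_def)
  qed
  from this[of "a 2"] have "h 1 (a 2) * (u * h 0 (a 1) + (- p)) = h 2 (a 2) + p * i"
    unfolding g by (simp add: algebra_simps)
  also have "\<dots> \<approx> 1 + (-1) * 0"
    by (intro cong3_add cong3_mult h2 p i) simp_all
  finally show ?thesis using u mp by (intro exI[of _ u] exI[of _ "- p"]) simp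
qed

lemma no_pentagon:
  assumes b: "b 0 = a 3" "b 1 = a 4" "b 2 = a 0" "b 3 = a 1" "b 4 = a 2"
  shows False
proof (rule no_mobius_5cycle[where e = "\<lambda>t. h t (a (t + 1))"])
  show "h 5 (a (5 + 1)) = h 0 (a (0 + 1))"
    using phi_per[of 0] phi_per[of 1] per0 by (simp add: h_def)
  have b2: "b (t + 2) = a t" for t
  proof (induction t rule: less_induct)
    case (less t)
    show ?case
    proof (cases "t < 5")
      case True
      then have "t = 0 \<or> t = 1 \<or> t = 2 \<or> t = 3 \<or> t = 4" by linarith
      then show ?thesis using b per0 by auto
    next
      case False
      then show ?thesis
        using less[of "t - 5"] a_per[of "t - 5"] b_per[of "t - 5 + 2"] by (simp add: add.commute)
    qed
  qed
  fix t
  interpret s: exchange_cycle L w "\<lambda>s. A (t + s)" "\<lambda>s. a (t + s)" "\<lambda>s. b (t + s)" "\<lambda>s. \<phi> (t + s)"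
    by (rule exchange_cycle_shift)
  have h: "s.h r = h (t + r)" for r
    by (rule ext) (simp add: s.h_def h_def add.assoc)
  have "b (t + 0) = a (t + 3)" "b (t + 1) = a (t + 4)"
    using b2[of "t + 3"] b2[of "t + 4"] b_per[of t] b_per[of "t + 1"]
    by (simp_all add: add.assoc)
  moreover have "b (t + 2) = a (t + 0)" "b (t + 3) = a (t + 1)" "b (t + 4) = a (t + 2)"
    using b2[of t] b2[of "t + 1"] b2[of "t + 2"] by (simp_all add: add.assoc)
  ultimately show "\<exists>u v. u \<approx> 1 \<and> v \<approx> 1 \<and>
      h (t + 1) (a (t + 1 + 1)) * (u * h t (a (t + 1)) + v) \<approx> 1"
    using s.pentagon_step unfolding h by (simp add: add.assoc)
qed

lemma no_bull_shift:
  assumes "b (r + 0) = a (r + 4)" "b (r + 1) = a (r + 3)" "b (r + 2) = a (r + 0)"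
    "b (r + 3) = a (r + 2)" "b (r + 4) = a (r + 1)"
  shows False
proof -
  interpret s: exchange_cycle L w "\<lambda>s. A (r + s)" "\<lambda>s. a (r + s)" "\<lambda>s. b (r + s)" "\<lambda>s. \<phi> (r + s)"
    by (rule exchange_cycle_shift)
  show False using s.no_bull assms .
qed

lemma no_square_with_tail_shift:
  assumes "b (r + 0) = a (r + 3)" "b (r + 1) = a (r + 0)" "b (r + 2) = a (r + 4)"
    "b (r + 3) = a (r + 1)" "b (r + 4) = a (r + 2)"
  shows False
proof -
  interpret s: exchange_cycle L w "\<lambda>s. A (r + s)" "\<lambda>s. a (r + s)" "\<lambda>s. b (r + s)" "\<lambda>s. \<phi> (r + s)"
    by (rule exchange_cycle_shift)
  show False using s.no_square_with_tail assms .
qed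

text \<open>The conditions of \<open>removed0\<close> leave the permutations of the five moved elements that are discordant
with two adjacent cyclic shifts. There are thirteen of them: three that are invariant under
rotation, and the five rotations each of the bull and of the square with a tail.\<close>

lemma no_exchange_cycle: False
proof -
  define cyc where "cyc x0 x1 x2 x3 x4 \<longleftrightarrow> b 0 = x0 \<and> b 1 = x1 \<and> b 2 = x2 \<and> b 3 = x3 \<and> b 4 = x4"
    for x0 x1 x2 x3 x4
  have "cyc (a 4) (a 0) (a 1) (a 2) (a 3) \<or> cyc (a 3) (a 4) (a 0) (a 1) (a 2) \<or>
      cyc (a 2) (a 3) (a 4) (a 0) (a 1) \<or>
      cyc (a 4) (a 3) (a 0) (a 2) (a 1) \<or> cyc (a 2) (a 0) (a 4) (a 1) (a 3) \<or>
      cyc (a 4) (a 3) (a 1) (a 0) (a 2) \<or> cyc (a 3) (a 0) (a 4) (a 2) (a 1) \<or>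
      cyc (a 2) (a 4) (a 1) (a 0) (a 3) \<or>
      cyc (a 3) (a 0) (a 4) (a 1) (a 2) \<or> cyc (a 3) (a 4) (a 1) (a 0) (a 2) \<or>
      cyc (a 3) (a 4) (a 0) (a 2) (a 1) \<or> cyc (a 2) (a 4) (a 0) (a 1) (a 3) \<or>
      cyc (a 4) (a 3) (a 0) (a 1) (a 2)"
    using removed0 distinct0 unfolding cyc_def
    by (elim disjE) simp_all
  then show False
    using no_singletons no_pentagon no_triples
      no_bull_shift[of 0] no_bull_shift[of 1] no_bull_shift[of 2] no_bull_shift[of 3] no_bull_shift[of 4]
      no_square_with_tail_shift[of 0] no_square_with_tail_shift[of 1] no_square_with_tail_shift[of 2] no_square_with_tail_shift[of 3]
      no_square_with_tail_shift[of 4]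
    unfolding cyc_def by (elim disjE conjE) (simp_all add: per0)
qed

end

section \<open>Generic integer columns and the edges they keep\<close>

definition lin :: "nat \<Rightarrow> (nat \<Rightarrow> nat \<Rightarrow> int) \<Rightarrow> (nat \<Rightarrow> rat) \<Rightarrow> nat \<Rightarrow> rat" where
  "lin K c y x = (\<Sum>j<K. y j * of_int (c x j))"

text \<open>No nonzero functional vanishes on \<open>K\<close> of the columns, that is, any \<open>K\<close> of them are linearly
independent.\<close>

definition generic :: "nat \<Rightarrow> (nat \<Rightarrow> nat \<Rightarrow> int) \<Rightarrow> nat set \<Rightarrow> bool" where
  "generic K c X \<longleftrightarrow> (\<forall>T y. T \<subseteq> X \<longrightarrow> card T = K \<longrightarrow>
     (\<forall>x\<in>T. lin K c y x = 0) \<longrightarrow> (\<forall>j<K. y j = 0))"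

text \<open>For generic columns, \<open>card A + 1 = K\<close> and \<open>w \<notin> A\<close>, the first two conditions determine the functional.\<close>

definition keeps :: "nat \<Rightarrow> (nat \<Rightarrow> nat \<Rightarrow> int) \<Rightarrow> nat \<Rightarrow> nat set \<Rightarrow> nat \<Rightarrow> bool" where
  "keeps K c w A i \<longleftrightarrow> (\<exists>y. (\<forall>x\<in>A. lin K c y x = 0) \<and> lin K c y w = 1 \<and> lin K c y i \<approx> 1)"

lemma lin_comb: "lin K c (\<lambda>j. y j + d * z j) x = lin K c y x + d * lin K c z x"
  by (simp add: lin_def sum.distrib sum_distrib_left algebra_simps)

text \<open>The sets \<open>A t\<close> and \<open>B t\<close> are the alternating lower and upper vertices of a closed walk of length
ten that never turns back. Choosing the functional of \<open>A t\<close> as a function of \<open>A t\<close> alone makes it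
periodic; it then serves both edges at \<open>A t\<close> because genericity makes it unique.\<close>

lemma no_kept_cycle:
  fixes A B :: "nat \<Rightarrow> nat set"
  assumes gen: "generic K c X" and w: "w \<in> X"
    and A: "\<And>t. A t \<subseteq> X - {w}" "\<And>t. finite (A t)" "\<And>t. Suc (card (A t)) = K"
    and per: "\<And>t. A (t + 5) = A t" "\<And>t. B (t + 5) = B t"
    and up: "\<And>t. \<exists>i. i \<notin> A t \<and> B t = insert i (A t) \<and> keeps K c w (A t) i"
    and down: "\<And>t. \<exists>i. i \<notin> A (t + 1) \<and> B t = insert i (A (t + 1)) \<and> keeps K c w (A (t + 1)) i"
    and neq: "\<And>t. A t \<noteq> A (t + 1)" "\<And>t. B t \<noteq> B (t + 1)"
  shows False
proof -
  define a where "a t = the_elem (B t - A t)" for t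
  define b where "b t = the_elem (B t - A (t + 1))" for t
  define P where "P t y \<longleftrightarrow> (\<forall>x\<in>A t. lin K c y x = 0) \<and> lin K c y w = 1" for t y
  define \<phi> where "\<phi> t = lin K c (SOME y. P t y)" for t
  have a: "a t \<notin> A t" "B t = insert (a t) (A t)" "keeps K c w (A t) (a t)" for t
  proof -
    obtain i where i: "i \<notin> A t" "B t = insert i (A t)" "keeps K c w (A t) i" using up by blast
    then have "B t - A t = {i}" by auto
    then have "a t = i" by (simp add: a_def)
    then show "a t \<notin> A t" "B t = insert (a t) (A t)" "keeps K c w (A t) (a t)" using i by simp_all
  qed
  have b: "b t \<notin> A (t + 1)" "B t = insert (b t) (A (t + 1))" "keeps K c w (A (t + 1)) (b t)" for t
  proof -
    obtain i where i: "i \<notin> A (t + 1)" "B t = insert i (A (t + 1))" "keeps K c w (A (t + 1)) i"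
      using down by blast
    then have "B t - A (t + 1) = {i}" by auto
    then have "b t = i" by (simp add: b_def)
    then show "b t \<notin> A (t + 1)" "B t = insert (b t) (A (t + 1))" "keeps K c w (A (t + 1)) (b t)"
      using i by simp_all
  qed
  have unique: "lin K c y x = 0" if "\<forall>x\<in>A t. lin K c y x = 0" "lin K c y w = 0" for t x y
  proof -
    have "insert w (A t) \<subseteq> X" "card (insert w (A t)) = K"
      using A[of t] w by (auto simp: card_insert_if)
    moreover have "\<forall>x\<in>insert w (A t). lin K c y x = 0" using that by blast
    ultimately have "\<forall>j<K. y j = 0" using gen unfolding generic_def by metis
    then show ?thesis by (simp add: lin_def)
  qed
  have same: "lin K c y x = lin K c z x" if "P t y" "P t z" for t x y z
    using unique[of t "\<lambda>j. y j + (-1) * z j" x] that unfolding lin_comb P_def by simp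
  have some: "P t (SOME y. P t y)" for t
  proof (rule someI_ex[of "P t" for t])
    show "\<exists>y. P t y" using a(3)[of t] unfolding keeps_def P_def by blast
  qed
  have phi: "\<phi> t i \<approx> 1" if k: "keeps K c w (A t) i" for t i
  proof -
    obtain y where "P t y" "lin K c y i \<approx> 1" using k unfolding keeps_def P_def by blast
    then show ?thesis using same[OF some] by (simp add: \<phi>_def)
  qed
  have "exchange_cycle (range (lin K c)) w A a b \<phi>"
  proof
    show "(\<lambda>x. f x + d * g x) \<in> range (lin K c)"
      if fg: "f \<in> range (lin K c)" "g \<in> range (lin K c)" for f g d
    proof -
      obtain y z where "f = lin K c y" "g = lin K c z" using fg by blast
      then have "(\<lambda>x. f x + d * g x) = lin K c (\<lambda>j. y j + d * z j)"
        by (auto simp: lin_comb)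
      then show ?thesis by blast
    qed
    fix t
    show "A (t + 5) = A t" by (rule per)
    show "a (t + 5) = a t" by (simp add: a_def per)
    have "A (t + 5 + 1) = A (t + 1)" using per(1)[of "t + 1"] by (simp add: add.commute)
    then show "b (t + 5) = b t" by (simp add: b_def per)
    show "\<phi> (t + 5) = \<phi> t" by (simp add: \<phi>_def P_def per)
    show "a t \<notin> A t" by (rule a)
    have At: "A t = B t - {a t}" "a t \<in> B t" using a(1,2)[of t] by auto
    have At1: "A (t + 1) = B t - {b t}" "b t \<in> B t" using b(1,2)[of t] by auto
    have ba: "b t \<noteq> a t" using At(1) At1(1) neq(1)[of t] by metis
    then show "b t \<in> A t" using At(1) At1(2) by blast
    show "A (t + 1) = insert (a t) (A t) - {b t}" unfolding At1(1) At(1) using At(2) by blast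
    show "b t \<noteq> a (t + 1)"
    proof
      assume "b t = a (t + 1)"
      then have "insert (b t) (A (t + 1)) = insert (a (t + 1)) (A (t + 1))" by (rule arg_cong)
      then show False using a(2)[of "t + 1"] b(2)[of t] neq(2)[of t] by metis
    qed
    show "\<phi> t \<in> range (lin K c)" by (simp add: \<phi>_def)
    show "\<phi> t w = 1" using some[of t] by (simp add: \<phi>_def P_def)
    show "\<phi> t x = 0" if "x \<in> A t" for x using that some[of t] by (simp add: \<phi>_def P_def)
    show "\<phi> t (a t) \<approx> 1" by (intro phi a)
    show "\<phi> (t + 1) (b t) \<approx> 1" by (intro phi b)
    show "f x = 0" if "f \<in> range (lin K c)" "f w = 0" "\<forall>x\<in>A t. f x = 0" for f x
      using that unique[of t] by auto
  qed
  then show False by (rule exchange_cycle.no_exchange_cycle)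
qed

text \<open>Lagrange's bound on the number of roots of a polynomial over a prime field, in terms of integer
polynomials.\<close>

lemma prime_dvd_coeffs_if_many_roots:
  fixes f :: "int poly"
  assumes p: "prime p" and "finite T" "degree f < card T" "\<And>x. x \<in> T \<Longrightarrow> p dvd poly f x"
    "\<And>x y. x \<in> T \<Longrightarrow> y \<in> T \<Longrightarrow> x \<noteq> y \<Longrightarrow> \<not> p dvd x - y"
  shows "[:p:] dvd f"
  using assms(2-)
proof (induction "card T" arbitrary: T f)
  case (Suc m)
  then obtain x where x: "x \<in> T" by fastforce
  define g where "g = synthetic_div f x"
  have f: "f = [:-x, 1:] * g + [:poly f x:]"
    by (simp only: g_def synthetic_div_correct')
  have px: "[:p:] dvd [:poly f x:]" using Suc.prems(3)[OF x] 
    by (auto simp: const_poly_dvd_iff coeff_pCons split: nat.splits)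
  show ?case
  proof (cases "degree f = 0")
    case True
    then have "g = 0" by (simp add: g_def synthetic_div_eq_0_iff)
    then show ?thesis using f px by simp
  next
    case False
    have "[:p:] dvd g"
    proof (rule Suc.hyps(1)[of "T - {x}"])
      show "m = card (T - {x})" using x Suc.hyps(2) Suc.prems(1) by simp
      show "degree g < card (T - {x})"
        using x Suc.prems(1,2) False by (simp add: g_def degree_synthetic_div)
      fix y assume y: "y \<in> T - {x}"
      have "poly f y = (y - x) * poly g y + poly f x"
        by (subst f) (simp add: algebra_simps)
      then have "p dvd (y - x) * poly g y"
        using Suc.prems(3)[of y] Suc.prems(3)[OF x] y by (simp add: dvd_add_left_iff)
      then show "p dvd poly g y"
        using Suc.prems(4)[of y x] x y p by (simp add: prime_dvd_mult_iff)
    qed (use Suc.prems in auto)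
    then show ?thesis using f px by (metis dvd_add dvd_mult)
  qed
qed simp

text \<open>Gaussian elimination without division: one equation is used to eliminate one unknown.\<close>

lemma homogeneous_solution:
  fixes m :: "'b \<Rightarrow> 'a \<Rightarrow> int"
  assumes "finite A" "finite J" "card A < card J"
  shows "\<exists>z. (\<exists>j\<in>J. z j \<noteq> 0) \<and> (\<forall>x\<in>A. (\<Sum>j\<in>J. z j * m x j) = 0)"
  using assms
proof (induction A arbitrary: J m rule: finite_induct)
  case empty
  then have "J \<noteq> {}" by auto
  then show ?case by (auto intro!: exI[of _ "\<lambda>_. 1"])
next
  case (insert x A)
  show ?case
  proof (cases "\<forall>j\<in>J. m x j = 0")
    case True
    then show ?thesis using insert.IH[of J m] insert by auto
  next
    case False
    then obtain i where i: "i \<in> J" "m x i \<noteq> 0" by auto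
    let ?J = "J - {i}"
    let ?m = "\<lambda>x' j. m x i * m x' j - m x j * m x' i"
    have "card A < card ?J" using insert i by simp
    then obtain z where z: "\<exists>j\<in>?J. z j \<noteq> 0" "\<forall>x'\<in>A. (\<Sum>j\<in>?J. z j * ?m x' j) = 0"
      using insert.IH[of ?J ?m] insert.prems by auto
    define z' where "z' j = (if j = i then - (\<Sum>j\<in>?J. z j * m x j) else m x i * z j)" for j
    have sum: "(\<Sum>j\<in>J. z' j * m x' j) = (\<Sum>j\<in>?J. z j * ?m x' j)" for x'
    proof -
      have "(\<Sum>j\<in>J. z' j * m x' j) = z' i * m x' i + (\<Sum>j\<in>?J. z' j * m x' j)"
        using i insert.prems by (simp add: sum.remove)
      also have "(\<Sum>j\<in>?J. z' j * m x' j) = (\<Sum>j\<in>?J. m x i * z j * m x' j)"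
        by (rule sum.cong) (auto simp: z'_def)
      also have "z' i * m x' i = - (\<Sum>j\<in>?J. z j * m x j * m x' i)"
        by (simp add: z'_def sum_distrib_right)
      finally show ?thesis
        by (simp add: sum_negf[symmetric] sum.distrib[symmetric] algebra_simps)
    qed
    have "\<exists>j\<in>J. z' j \<noteq> 0" using z(1) i by (auto simp: z'_def)
    moreover have "(\<Sum>j\<in>J. z' j * m x j) = 0" unfolding sum by (simp add: algebra_simps)
    ultimately show ?thesis using z(2) sum by (intro exI[of _ z']) auto
  qed
qed

lemma primitive_part:
  fixes z :: "'a \<Rightarrow> int"
  assumes "\<exists>j\<in>J. z j \<noteq> 0"
  obtains g z' where "g \<noteq> 0" "\<And>j. j \<in> J \<Longrightarrow> z j = g * z' j"
    "\<And>p. prime p \<Longrightarrow> \<exists>j\<in>J. \<not> p dvd z' j"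
proof
  define g where "g = Gcd (z ` J)"
  show g0: "g \<noteq> 0" using assms by (auto simp: g_def)
  show e: "z j = g * (z j div g)" if "j \<in> J" for j
    using that by (simp add: g_def)
  fix p :: int assume p: "prime p"
  show "\<exists>j\<in>J. \<not> p dvd z j div g"
  proof (rule ccontr)
    assume "\<not> ?thesis"
    then have "g * p dvd z j" if "j \<in> J" for j
      using e[OF that] that by (metis dvd_refl mult_dvd_mono)
    then have "g * p dvd g" unfolding g_def by (intro Gcd_greatest) auto
    then have "g * p dvd g * 1" by simp
    then have "p dvd 1" using g0 by (simp only: dvd_mult_cancel_left) simp
    then show False using p by (simp add: prime_int_iff)
  qed
qed

lemma common_denominator:
  fixes y :: "nat \<Rightarrow> rat"
  obtains d z where "d \<noteq> 0" "\<And>j. j < K \<Longrightarrow> of_int (z j) = of_int d * y j"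
proof -
  have "\<exists>d. d \<noteq> 0 \<and> (\<forall>j<K. \<exists>z. of_int z = of_int d * y j)" for K
  proof (induction K)
    case (Suc K)
    then obtain d where d: "d \<noteq> 0" "\<forall>j<K. \<exists>z. of_int z = of_int d * y j" by blast
    obtain m n where y: "y K = of_int m / of_int n" "n \<noteq> 0"
      by (metis quotient_of_div quotient_of_denom_pos less_irrefl surj_pair)
    have "\<exists>z. of_int z = of_int (n * d) * y j" if jK: "j < Suc K" for j
    proof (cases "j = K")
      case True
      then show ?thesis using y by (intro exI[of _ "d * m"]) simp
    next
      case False
      then obtain z where "of_int z = of_int d * y j" using d jK by (meson less_SucE)
      then show ?thesis by (intro exI[of _ "n * z"]) simp
    qed
    then show ?case using d(1) y(2) by (intro exI[of _ "n * d"]) simp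
  qed (auto intro: exI[of _ 1])
  then obtain d where "d \<noteq> 0" "\<forall>j<K. \<exists>z. of_int z = of_int d * y j" by blast
  then show thesis using that by metis
qed

text \<open>A nonzero functional over the rationals that vanishes on \<open>K\<close> columns can be scaled to an integer one that
is nonzero modulo \<open>p\<close>. Modulo \<open>p\<close> it is the coefficient vector of a polynomial of degree less than
\<open>K\<close> with \<open>K\<close> roots among \<open>0, \<dots>, n\<close>, and these are distinct modulo \<open>p\<close>.\<close>

lemma generic_if_vandermonde_mod:
  assumes p: "prime p" "int n < p"
    and c: "\<And>x j. x \<le> n \<Longrightarrow> j < K \<Longrightarrow> p dvd c x j - int x ^ j"
  shows "generic K c {..n}"
  unfolding generic_def
proof (intro allI impI)
  fix T y i
  assume T: "T \<subseteq> {..n}" "card T = K" "\<forall>x\<in>T. lin K c y x = 0" and i: "i < K"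
  show "y i = 0"
  proof (rule ccontr)
    assume yi: "y i \<noteq> 0"
    obtain d z where d: "d \<noteq> 0" "\<And>j. j < K \<Longrightarrow> of_int (z j) = of_int d * y j"
      using common_denominator[of K y] by blast
    have "of_int (z i) \<noteq> (0 :: rat)" using d(1) d(2)[OF i] yi by simp
    then have "\<exists>j\<in>{..<K}. z j \<noteq> 0" using i by auto
    then obtain g z' where z': "g \<noteq> 0" "\<And>j. j \<in> {..<K} \<Longrightarrow> z j = g * z' j"
      "\<And>p. prime p \<Longrightarrow> \<exists>j\<in>{..<K}. \<not> p dvd z' j"
      using primitive_part[of "{..<K}" z] by blast
    define f where "f = (\<Sum>j<K. monom (z' j) j)"
    have coeff: "coeff f j = z' j" if "j < K" for j
      using that by (simp add: f_def coeff_sum)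
    have "degree f < K"
    proof -
      have "degree f \<le> K - 1" unfolding f_def
        by (rule degree_sum_le) (auto intro: order.trans[OF degree_monom_le])
      then show ?thesis using i by linarith
    qed
    moreover have "p dvd poly f (int x)" if x: "x \<in> T" for x
    proof -
      have "0 = of_int d * lin K c y x" using T x by simp
      also have "\<dots> = (\<Sum>j<K. of_int (z j * c x j))"
        unfolding lin_def sum_distrib_left using d(2) by (intro sum.cong) auto
      also have "\<dots> = of_int (\<Sum>j<K. z j * c x j)" by simp
      finally have "(\<Sum>j<K. z j * c x j) = 0" by (metis of_int_eq_0_iff)
      also have "(\<Sum>j<K. z j * c x j) = g * (\<Sum>j<K. z' j * c x j)"
        unfolding sum_distrib_left using z'(2) by (intro sum.cong) auto
      finally have 0: "(\<Sum>j<K. z' j * c x j) = 0" using z'(1) by simp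
      have "p dvd (\<Sum>j<K. z' j * (c x j - int x ^ j))"
        using c T x by (intro dvd_sum dvd_mult) auto
      also have "(\<Sum>j<K. z' j * (c x j - int x ^ j)) = - poly f (int x)"
        using 0 by (simp add: f_def poly_sum poly_monom algebra_simps sum_subtractf)
      finally show ?thesis by simp
    qed
    moreover have "\<not> p dvd int x - int x'" if "x \<in> T" "x' \<in> T" "x \<noteq> x'" for x x'
    proof -
      have "x \<le> n" "x' \<le> n" using T that by auto
      then have "\<bar>int x - int x'\<bar> < p" "int x - int x' \<noteq> 0" using p that by auto
      then show ?thesis by (metis abs_of_pos dvd_imp_le_int not_less zero_less_abs_iff less_trans)
    qed
    moreover have "finite T" using T finite_subset by blast
    ultimately have "[:p:] dvd f"
      using T(2) by (intro prime_dvd_coeffs_if_many_roots[OF p(1), of "int ` T"])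
        (auto simp: card_image)
    then have "p dvd z' j" if "j < K" for j
      using coeff[OF that] by (metis const_poly_dvd_iff)
    then show False using z'(3)[OF p(1)] by auto
  qed
qed

section \<open>Random columns keep a quarter of a layer\<close>

text \<open>The same 3-adic valuation and the same leading digit; in particular, neither number is zero.\<close>

definition match3 :: "int \<Rightarrow> int \<Rightarrow> bool" where
  "match3 u v \<longleftrightarrow> (\<exists>m u' v'. u = 3 ^ m * u' \<and> v = 3 ^ m * v' \<and> \<not> 3 dvd u' \<and> 3 dvd v' - u')"

lemma match3_cong3:
  assumes "match3 u v" shows "u \<noteq> 0" "of_int v / of_int u \<approx> 1"
proof -
  obtain m u' v' where e: "u = 3 ^ m * u'" "v = 3 ^ m * v'" "\<not> 3 dvd u'" "3 dvd v' - u'"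
    using assms by (auto simp: match3_def)
  then have u': "u' \<noteq> 0" by auto
  then show "u \<noteq> 0" using e by simp
  obtain q where q: "v' = 3 * q + u'" using e(4) by (metis diff_add_cancel dvd_def)
  have "(of_int v / of_int u - 1) / 3 = (of_int q / of_int u' :: rat)"
    using u' e(1,2) q by (simp add: field_simps)
  then show "of_int v / of_int u \<approx> 1" using integral3I[OF e(3)] by (simp add: cong3_def)
qed

lemma match3_mult3: "match3 u v \<Longrightarrow> match3 (3 * u) (3 * v)"
proof -
  assume "match3 u v"
  then obtain m u' v' where e: "u = 3 ^ m * u'" "v = 3 ^ m * v'" "\<not> 3 dvd u'" "3 dvd v' - u'"
    by (auto simp: match3_def)
  then show ?thesis
    unfolding match3_def by (intro exI[of _ "Suc m"] exI[of _ u'] exI[of _ v']) simp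
qed

text \<open>A nonzero residue modulo \<open>3 ^ N\<close> shows the valuation and the leading digit of the number, and
\<open>match3\<close> only admits nonzero residues.\<close>

lemma match3_mod:
  assumes "match3 (u mod 3 ^ N) (v mod 3 ^ N)" shows "match3 u v"
proof -
  obtain m u' v' where e: "u mod 3 ^ N = 3 ^ m * u'" "v mod 3 ^ N = 3 ^ m * v'"
    "\<not> 3 dvd u'" "3 dvd v' - u'"
    using assms by (auto simp: match3_def)
  have m: "m < N"
  proof (rule ccontr)
    assume "\<not> m < N"
    then have "(3::int) ^ N dvd 3 ^ m" by (simp add: le_imp_power_dvd)
    then have "3 ^ N dvd u mod 3 ^ N" using e(1) by simp
    then have "u mod 3 ^ N mod 3 ^ N = 0" by (rule dvd_imp_mod_0)
    then have "u mod 3 ^ N = 0" by simp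
    then show False using e(1,3) by auto
  qed
  define d where "d = N - Suc m"
  have N: "(3::int) ^ N = 3 ^ m * (3 * 3 ^ d)"
  proof -
    have "N = m + Suc d" using m by (simp add: d_def)
    then show ?thesis by (simp only: power_add power_Suc)
  qed
  have "u = 3 ^ m * (u' + 3 * (3 ^ d * (u div 3 ^ N)))"
    using e(1) mult_div_mod_eq[of "3 ^ N" u] unfolding N by (simp add: algebra_simps)
  moreover have "v = 3 ^ m * (v' + 3 * (3 ^ d * (v div 3 ^ N)))"
    using e(2) mult_div_mod_eq[of "3 ^ N" v] unfolding N by (simp add: algebra_simps)
  moreover have "\<not> 3 dvd u' + 3 * (3 ^ d * (u div 3 ^ N))" using e(3) by (simp add: dvd_add_left_iff)
  moreover have "3 dvd (v' + 3 * (3 ^ d * (v div 3 ^ N))) - (u' + 3 * (3 ^ d * (u div 3 ^ N)))"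
  proof -
    have "3 dvd (v' - u') + 3 * (3 ^ d * (v div 3 ^ N) - 3 ^ d * (u div 3 ^ N))"
      using e(4) by (rule dvd_add) simp
    also have "(v' - u') + 3 * (3 ^ d * (v div 3 ^ N) - 3 ^ d * (u div 3 ^ N)) =
        (v' + 3 * (3 ^ d * (v div 3 ^ N))) - (u' + 3 * (3 ^ d * (u div 3 ^ N)))"
      by (simp add: algebra_simps)
    finally show ?thesis .
  qed
  ultimately show ?thesis unfolding match3_def by blast
qed

definition matches :: "nat \<Rightarrow> (int \<times> int) set" where
  "matches N = {(u, v). u \<in> {0..<3 ^ N} \<and> v \<in> {0..<3 ^ N} \<and> match3 u v}"

lemma finite_matches: "finite (matches N)"
  by (rule finite_subset[of _ "{0..<3 ^ N} \<times> {0..<3 ^ N}"]) (auto simp: matches_def)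

text \<open>Equality holds. The pairs of units with equal residue modulo 3 number \<open>2 * 9 ^ N\<close> among the
pairs of residues modulo \<open>3 ^ (N + 1)\<close>, and the other matching pairs are three times a matching
pair modulo \<open>3 ^ N\<close>. The limit frequency is thus \<open>2 / 9 + 2 / 9\<^sup>2 + \<dots> = 1 / 4\<close>.\<close>

lemma card_matches: "9 ^ N \<le> 4 * card (matches N) + 1"
proof (induction N)
  case (Suc N)
  let ?D = "{0..<3 ^ N} :: int set"
  define R :: "int set" where "R = {1, 2}"
  define F :: "int \<times> int \<times> int \<Rightarrow> int \<times> int" where "F = (\<lambda>(r, x, y). (3 * x + r, 3 * y + r))"
  define U where "U = F ` (R \<times> ?D \<times> ?D)"
  define V where "V = (\<lambda>(u, v). (3 * u, 3 * v)) ` matches N"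
  have R: "(3 * x + r) mod 3 = r" "r \<noteq> 0" "0 \<le> r" "r < 3" if "r \<in> R" for x r :: int
    using that by (auto simp: R_def)
  have FU: "\<exists>r x y. r \<in> R \<and> x \<in> ?D \<and> y \<in> ?D \<and> w = (3 * x + r, 3 * y + r)" if wU: "w \<in> U" for w
  proof -
    obtain p where p: "p \<in> R \<times> ?D \<times> ?D" "w = F p" using wU unfolding U_def by (rule imageE)
    obtain r x y where "p = (r, x, y)" by (rule prod_cases3)
    then show ?thesis using p by (intro exI[of _ r] exI[of _ x] exI[of _ y]) (simp add: F_def)
  qed
  have FV: "\<exists>u v. (u, v) \<in> matches N \<and> w = (3 * u, 3 * v)" if wV: "w \<in> V" for w
  proof -
    obtain p where p: "p \<in> matches N" "w = (\<lambda>(u, v). (3 * u, 3 * v)) p"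
      using wV unfolding V_def by (rule imageE)
    then show ?thesis by (intro exI[of _ "fst p"] exI[of _ "snd p"]) (simp add: case_prod_unfold)
  qed
  have "U \<subseteq> matches (Suc N)"
  proof
    fix w assume "w \<in> U"
    then obtain r x y where w: "r \<in> R" "x \<in> ?D" "y \<in> ?D" "w = (3 * x + r, 3 * y + r)"
      using FU by blast
    have "match3 (3 * x + r) (3 * y + r)"
      unfolding match3_def
    proof (intro exI conjI)
      show "3 * x + r = 3 ^ 0 * (3 * x + r)" "3 * y + r = 3 ^ 0 * (3 * y + r)" by simp_all
      show "\<not> 3 dvd 3 * x + r" using R(1)[OF w(1), of x] R(2)[OF w(1)] by (simp only: dvd_eq_mod_eq_0) simp
      have "3 * y + r - (3 * x + r) = 3 * (y - x)" by simp
      then show "3 dvd 3 * y + r - (3 * x + r)" by (metis dvd_triv_left)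
    qed
    then show "w \<in> matches (Suc N)" using w R[OF w(1)] by (auto simp: matches_def)
  qed
  moreover have "V \<subseteq> matches (Suc N)"
    by (auto simp: V_def matches_def match3_mult3)
  ultimately have "card (U \<union> V) \<le> card (matches (Suc N))"
    by (intro card_mono finite_matches) auto
  moreover have "card (U \<union> V) = card U + card V"
  proof (rule card_Un_disjoint)
    have "fst w mod 3 \<noteq> 0" if wU: "w \<in> U" for w
    proof -
      obtain r x y where r: "r \<in> R" "w = (3 * x + r, 3 * y + r)" using FU[OF wU] by blast
      show ?thesis using R(1)[OF r(1), of x] R(2)[OF r(1)] unfolding r(2) fst_conv by simp
    qed
    moreover have "fst w mod 3 = 0" if "w \<in> V" for w using FV[OF that] by auto
    ultimately show "U \<inter> V = {}" by blast
  qed (auto simp: U_def V_def R_def finite_matches)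
  moreover have "card U = 2 * 9 ^ N"
  proof -
    have "inj_on F (R \<times> ?D \<times> ?D)"
    proof (rule inj_onI)
      fix p q assume pq: "p \<in> R \<times> ?D \<times> ?D" "q \<in> R \<times> ?D \<times> ?D" "F p = F q"
      obtain r x y r' x' y' where e: "p = (r, x, y)" "q = (r', x', y')" by (metis prod_cases3)
      have r: "r \<in> R" "r' \<in> R" and eq: "3 * x + r = 3 * x' + r'" "3 * y + r = 3 * y' + r'"
        using pq unfolding e F_def by simp_all
      have "r = r'" using R(1)[OF r(1), of x] R(1)[OF r(2), of x'] eq(1) by simp
      then show "p = q" using e eq by simp
    qed
    then have "card U = card (R \<times> ?D \<times> ?D)" unfolding U_def by (rule card_image)
    also have "\<dots> = 2 * (3 ^ N * 3 ^ N)" by (simp add: card_cartesian_product R_def nat_power_eq)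
    also have "(3::nat) ^ N * 3 ^ N = 9 ^ N" by (simp flip: power_mult_distrib)
    finally show ?thesis .
  qed
  moreover have "card V = card (matches N)"
    unfolding V_def by (rule card_image) (auto simp: inj_on_def)
  ultimately show ?case using Suc by simp
qed simp

lemma card_affine_matches:
  assumes "\<not> 3 dvd \<alpha>"
  shows "card (matches N) \<le> card {(s, t). s \<in> {0..<3 ^ N} \<and> t \<in> {0..<3 ^ N} \<and>
    match3 (\<alpha> * s + \<beta>) (\<alpha> * t + \<gamma>)}"
proof -
  let ?Q = "3 ^ N :: int" and ?D = "{0..<3 ^ N} :: int set"
  have onto: "\<exists>s\<in>?D. (\<alpha> * s + \<delta>) mod ?Q = u" if u: "u \<in> ?D" for u \<delta>
  proof -
    have "inj_on (\<lambda>s. (\<alpha> * s + \<delta>) mod ?Q) ?D"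
    proof (rule inj_onI)
      fix s t assume st: "s \<in> ?D" "t \<in> ?D" "(\<alpha> * s + \<delta>) mod ?Q = (\<alpha> * t + \<delta>) mod ?Q"
      then have "?Q dvd (\<alpha> * s + \<delta>) - (\<alpha> * t + \<delta>)" by (simp add: mod_eq_dvd_iff)
      then have "?Q dvd \<alpha> * (s - t)" by (simp add: algebra_simps)
      moreover have "coprime ?Q \<alpha>"
        using prime_imp_coprime[OF prime3 assms] by simp
      ultimately have "?Q dvd s - t" by (simp add: coprime_dvd_mult_right_iff)
      then have "s mod ?Q = t mod ?Q" by (simp add: mod_eq_dvd_iff)
      then show "s = t" using st(1,2) by (simp add: mod_pos_pos_trivial)
    qed
    moreover have "(\<lambda>s. (\<alpha> * s + \<delta>) mod ?Q) ` ?D \<subseteq> ?D" by auto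
    ultimately have "(\<lambda>s. (\<alpha> * s + \<delta>) mod ?Q) ` ?D = ?D" by (intro endo_inj_surj) auto
    then show ?thesis using u by (metis (no_types, lifting) imageE)
  qed
  let ?S = "{(s, t). s \<in> ?D \<and> t \<in> ?D \<and> match3 (\<alpha> * s + \<beta>) (\<alpha> * t + \<gamma>)}"
  let ?F = "\<lambda>(s, t). ((\<alpha> * s + \<beta>) mod ?Q, (\<alpha> * t + \<gamma>) mod ?Q)"
  have fin: "finite ?S" by (rule finite_subset[of _ "?D \<times> ?D"]) auto
  have "matches N \<subseteq> ?F ` ?S"
  proof
    fix w assume "w \<in> matches N"
    then obtain u v where w: "w = (u, v)" "u \<in> ?D" "v \<in> ?D" "match3 u v"
      by (auto simp: matches_def)
    obtain s where s: "s \<in> ?D" "(\<alpha> * s + \<beta>) mod ?Q = u" using onto[OF w(2)] by blast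
    obtain t where t: "t \<in> ?D" "(\<alpha> * t + \<gamma>) mod ?Q = v" using onto[OF w(3)] by blast
    have "match3 (\<alpha> * s + \<beta>) (\<alpha> * t + \<gamma>)"
      using w(4) unfolding s(2)[symmetric] t(2)[symmetric] by (rule match3_mod)
    then have "(s, t) \<in> ?S" using s(1) t(1) by blast
    moreover have "w = ?F (s, t)" unfolding w(1) prod.case s(2) t(2) ..
    ultimately show "w \<in> ?F ` ?S" by (rule rev_image_eqI)
  qed
  then have "card (matches N) \<le> card (?F ` ?S)" using fin by (intro card_mono finite_imageI)
  also have "\<dots> \<le> card ?S" using fin by (rule card_image_le)
  finally show ?thesis .
qed

text \<open>Redrawing one coordinate of a uniformly random function does not change expectations. The
bijection behind this exchanges the old and the new value of the coordinate.\<close>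

lemma sum_resample:
  assumes "finite I" "i \<in> I" "finite D"
  shows "(\<Sum>r\<in>I \<rightarrow>\<^sub>E D. \<Sum>s\<in>D. f (r(i := s))) = card D * (\<Sum>r\<in>I \<rightarrow>\<^sub>E D. f r :: nat)"
proof -
  let ?R = "I \<rightarrow>\<^sub>E D"
  have "(\<Sum>r\<in>?R. \<Sum>s\<in>D. f (r(i := s))) = (\<Sum>(r, s)\<in>?R \<times> D. f (r(i := s)))"
    using assms by (simp add: sum.cartesian_product)
  also have "\<dots> = (\<Sum>(r, s)\<in>?R \<times> D. f r)"
    by (rule sum.reindex_bij_witness[where i = "\<lambda>(r, s). (r(i := s), r i)"
          and j = "\<lambda>(r, s). (r(i := s), r i)"])
      (use assms in \<open>auto simp: PiE_def extensional_def Pi_def\<close>)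
  also have "\<dots> = (\<Sum>r\<in>?R. \<Sum>s\<in>D. f r)"
    by (rule sum.cartesian_product[symmetric])
  finally show ?thesis by (simp add: sum_distrib_left)
qed

lemma card_filter: "finite A \<Longrightarrow> card {x \<in> A. P x} = (\<Sum>x\<in>A. of_bool (P x))"
  by (simp add: Int_def)

lemma keeps_if_match3:
  fixes z :: "nat \<Rightarrow> int"
  assumes "\<And>x. x \<in> A \<Longrightarrow> (\<Sum>j<K. z j * c x j) = 0"
    and m: "match3 (\<Sum>j<K. z j * c w j) (\<Sum>j<K. z j * c i j)"
  shows "keeps K c w A i"
proof -
  define u where "u = (\<Sum>j<K. z j * c w j)"
  define y where "y j = of_int (z j) / (of_int u :: rat)" for j
  have lin: "lin K c y x = of_int (\<Sum>j<K. z j * c x j) / of_int u" for x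
    by (simp add: lin_def y_def sum_divide_distrib)
  have "u \<noteq> 0" using match3_cong3(1)[OF m] by (simp add: u_def)
  then have "lin K c y w = 1" by (simp add: lin u_def del: of_int_sum of_int_mult)
  moreover have "lin K c y i \<approx> 1" using match3_cong3(2)[OF m] by (simp add: lin u_def)
  moreover have "\<forall>x\<in>A. lin K c y x = 0" using assms(1) by (simp add: lin del: of_int_sum of_int_mult)
  ultimately show ?thesis unfolding keeps_def by blast
qed

text \<open>An integer functional that vanishes on the columns of \<open>A\<close> and is nonzero modulo 3. It is chosen
depending on these columns only, so that it remains the same when other columns are redrawn.\<close>

definition normal_vector :: "nat \<Rightarrow> (nat \<Rightarrow> nat \<Rightarrow> int) \<Rightarrow> nat set \<Rightarrow> nat \<Rightarrow> int" where
  "normal_vector K c A =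
    (SOME z. (\<forall>x\<in>A. (\<Sum>j<K. z j * c x j) = 0) \<and> (\<exists>j<K. \<not> 3 dvd z j))"

lemma normal_vector:
  assumes "finite A" "card A < K"
  shows "\<And>x. x \<in> A \<Longrightarrow> (\<Sum>j<K. normal_vector K c A j * c x j) = 0"
    "\<exists>j<K. \<not> 3 dvd normal_vector K c A j"
proof -
  obtain z where z: "\<exists>j\<in>{..<K}. z j \<noteq> 0" "\<forall>x\<in>A. (\<Sum>j<K. z j * c x j) = 0"
    using homogeneous_solution[of A "{..<K}" c] assms by auto
  obtain g z' where z': "g \<noteq> 0" "\<And>j. j \<in> {..<K} \<Longrightarrow> z j = g * z' j"
    "\<And>p. prime p \<Longrightarrow> \<exists>j\<in>{..<K}. \<not> p dvd z' j"
    using primitive_part[OF z(1)] by blast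
  have "(\<Sum>j<K. z' j * c x j) = 0" if "x \<in> A" for x
  proof -
    have "g * (\<Sum>j<K. z' j * c x j) = (\<Sum>j<K. z j * c x j)"
      unfolding sum_distrib_left using z'(2) by (intro sum.cong) auto
    then show ?thesis using z(2) z'(1) that by simp
  qed
  then have "\<exists>z. (\<forall>x\<in>A. (\<Sum>j<K. z j * c x j) = 0) \<and> (\<exists>j<K. \<not> 3 dvd z j)"
    using z'(3)[OF prime3] by blast
  from someI_ex[OF this]
  show "\<And>x. x \<in> A \<Longrightarrow> (\<Sum>j<K. normal_vector K c A j * c x j) = 0"
    "\<exists>j<K. \<not> 3 dvd normal_vector K c A j"
    unfolding normal_vector_def by blast+
qed

lemma normal_vector_cong:
  assumes "\<And>x. x \<in> A \<Longrightarrow> c x = c' x"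
  shows "normal_vector K c A = normal_vector K c' A"
proof -
  have "(\<forall>x\<in>A. (\<Sum>j<K. z j * c x j) = 0) \<longleftrightarrow> (\<forall>x\<in>A. (\<Sum>j<K. z j * c' x j) = 0)" for z
    using assms by simp
  then show ?thesis unfolding normal_vector_def by simp
qed

text \<open>The columns are Vandermonde vectors plus \<open>p\<close> times a random vector. Modulo \<open>p\<close> they are fixed,
which makes them generic if \<open>p\<close> is a prime above \<open>n\<close>, and modulo \<open>3 ^ N\<close> they are uniform because 3 does not divide \<open>p\<close>.\<close>

locale random_columns =
  fixes n K N :: nat and p :: int
  assumes p3: "\<not> 3 dvd p"
begin

abbreviation D :: "int set" where "D \<equiv> {0..<3 ^ N}"

definition I :: "(nat \<times> nat) set" where "I = {..n} \<times> {..<K}"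

abbreviation R :: "(nat \<times> nat \<Rightarrow> int) set" where "R \<equiv> I \<rightarrow>\<^sub>E D"

definition cols :: "(nat \<times> nat \<Rightarrow> int) \<Rightarrow> nat \<Rightarrow> nat \<Rightarrow> int" where
  "cols r x j = int x ^ j + p * r (x, j)"

lemma finite_I: "finite I" and finite_R: "finite R"
  by (auto simp: I_def intro!: finite_PiE)

lemma card_D: "card D * card D = 9 ^ N"
proof -
  have "card D = 3 ^ N" by (simp add: nat_power_eq)
  moreover have "(3::nat) ^ N * 3 ^ N = 9 ^ N" by (simp flip: power_mult_distrib)
  ultimately show ?thesis by (simp only:)
qed

text \<open>An entry at which the normal vector of \<open>A\<close> is a unit modulo 3. Redrawing this entry in another
column makes the value of the functional at that column uniform modulo \<open>3 ^ N\<close>.\<close>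

definition pivot :: "nat set \<Rightarrow> (nat \<times> nat \<Rightarrow> int) \<Rightarrow> nat" where
  "pivot A r = (LEAST j. \<not> 3 dvd normal_vector K (cols r) A j)"

lemma pivot:
  assumes "finite A" "card A < K"
  shows "pivot A r < K" "\<not> 3 dvd normal_vector K (cols r) A (pivot A r)"
proof -
  obtain j where j: "j < K" "\<not> 3 dvd normal_vector K (cols r) A j"
    using normal_vector(2)[OF assms] by blast
  show "\<not> 3 dvd normal_vector K (cols r) A (pivot A r)"
    unfolding pivot_def by (rule LeastI, rule j)
  have "pivot A r \<le> j"
    unfolding pivot_def by (rule Least_le, rule j)
  then show "pivot A r < K" using j by simp
qed

lemma sum_cols_upd:
  assumes "j < K"
  shows "(\<Sum>i<K. z i * cols (r((x, j) := s)) x i) =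
    z j * p * s + ((\<Sum>i<K. z i * cols r x i) - z j * p * r (x, j))"
proof -
  have split: "(\<Sum>i<K. z i * cols r' x i) = z j * cols r' x j + (\<Sum>i\<in>{..<K} - {j}. z i * cols r' x i)" for r'
    using assms by (simp add: sum.remove)
  have rest: "(\<Sum>i\<in>{..<K} - {j}. z i * cols (r((x, j) := s)) x i) = (\<Sum>i\<in>{..<K} - {j}. z i * cols r x i)"
    by (rule sum.cong) (auto simp: cols_def)
  have "z j * cols (r((x, j) := s)) x j = z j * p * s + (z j * cols r x j - z j * p * r (x, j))"
    by (simp add: cols_def algebra_simps)
  then show ?thesis unfolding split[of "r((x, j) := s)"] split[of r] rest by simp
qed

text \<open>Redraw the pivot entries of the columns \<open>n\<close> and \<open>i\<close>. The normal vector and the pivot of \<open>A\<close> do not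
change, while the values of the functional at both columns run over all pairs of residues. Fixing
the pivot \<open>j\<close> ensures that the redrawn coordinates do not depend on the random function.\<close>

lemma card_pivot_keeps:
  assumes A: "A \<subseteq> {..<n}" "card A < K" and i: "i < n" "i \<notin> A" and j: "j < K"
  shows "card (matches N) * card {r \<in> R. pivot A r = j} \<le>
    9 ^ N * card {r \<in> R. pivot A r = j \<and> keeps K (cols r) n A i}"
proof -
  have finA: "finite A" using A finite_subset by blast
  define f :: "(nat \<times> nat \<Rightarrow> int) \<Rightarrow> nat"
    where "f r = of_bool (pivot A r = j \<and> keeps K (cols r) n A i)" for r
  have inI: "(n, j) \<in> I" "(i, j) \<in> I" using i j by (auto simp: I_def)
  have "card (matches N) \<le> (\<Sum>s\<in>D. \<Sum>t\<in>D. f (r((n, j) := s, (i, j) := t)))"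
    if r: "r \<in> R" "pivot A r = j" for r
  proof -
    \<comment> \<open>The values at the columns \<open>n\<close> and \<open>i\<close> are affine in the redrawn entries, with the same unit slope.\<close>
    define z where "z = normal_vector K (cols r) A"
    define \<beta> where "\<beta> = (\<Sum>l<K. z l * cols r n l) - z j * p * r (n, j)"
    define \<gamma> where "\<gamma> = (\<Sum>l<K. z l * cols r i l) - z j * p * r (i, j)"
    let ?r = "\<lambda>s t. r((n, j) := s, (i, j) := t)"
    have z3: "\<not> 3 dvd z j" using pivot(2)[OF finA A(2), of r] r by (simp add: z_def)
    then have zp: "\<not> 3 dvd z j * p" using p3 by (simp add: prime_dvd_mult_iff[OF prime3])
    have same: "cols (?r s t) x = cols r x" if "x \<in> A" for s t x
    proof -
      have "x \<noteq> n" "x \<noteq> i" using that A i by auto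
      then show ?thesis by (auto simp: cols_def)
    qed
    have nv: "normal_vector K (cols (?r s t)) A = z" for s t
      unfolding z_def by (rule normal_vector_cong) (rule same)
    then have piv: "pivot A (?r s t) = j" for s t
      using r(2) by (simp add: pivot_def z_def)
    have un: "(\<Sum>l<K. z l * cols (?r s t) n l) = z j * p * s + \<beta>" for s t
    proof -
      have "(\<Sum>l<K. z l * cols (?r s t) n l) = (\<Sum>l<K. z l * cols (r((n, j) := s)) n l)"
        using i by (intro sum.cong) (auto simp: cols_def)
      then show ?thesis using sum_cols_upd[OF j] by (simp add: \<beta>_def)
    qed
    have ui: "(\<Sum>l<K. z l * cols (?r s t) i l) = z j * p * t + \<gamma>" for s t
    proof -
      have "(\<Sum>l<K. z l * cols (?r s t) i l) = (\<Sum>l<K. z l * cols (r((i, j) := t)) i l)"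
        using i by (intro sum.cong) (auto simp: cols_def)
      then show ?thesis using sum_cols_upd[OF j] by (simp add: \<gamma>_def)
    qed
    have f1: "f (?r s t) = 1" if "match3 (z j * p * s + \<beta>) (z j * p * t + \<gamma>)" for s t
    proof -
      have "keeps K (cols (?r s t)) n A i"
      proof (rule keeps_if_match3[where z = z])
        show "(\<Sum>l<K. z l * cols (?r s t) x l) = 0" if "x \<in> A" for x
          using normal_vector(1)[OF finA A(2) that, of "cols (?r s t)"] unfolding nv .
      qed (unfold un ui, rule that)
      then show ?thesis using piv by (simp add: f_def)
    qed
    let ?M = "{(s, t). s \<in> D \<and> t \<in> D \<and> match3 (z j * p * s + \<beta>) (z j * p * t + \<gamma>)}"
    have M: "?M \<subseteq> D \<times> D" by blast
    have "card (matches N) \<le> card ?M" by (rule card_affine_matches[OF zp])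
    also have "\<dots> = (\<Sum>(s, t)\<in>?M. f (?r s t))" using f1 by (simp add: case_prod_unfold split_beta)
    also have "\<dots> \<le> (\<Sum>(s, t)\<in>D \<times> D. f (?r s t))" by (rule sum_mono2) (use M in auto)
    finally show ?thesis by (simp add: sum.cartesian_product)
  qed
  then have "(\<Sum>r\<in>{r \<in> R. pivot A r = j}. card (matches N)) \<le>
      (\<Sum>r\<in>{r \<in> R. pivot A r = j}. \<Sum>s\<in>D. \<Sum>t\<in>D. f (r((n, j) := s, (i, j) := t)))"
    by (intro sum_mono) auto
  also have "\<dots> \<le> (\<Sum>r\<in>R. \<Sum>s\<in>D. \<Sum>t\<in>D. f (r((n, j) := s, (i, j) := t)))"
    by (rule sum_mono2) (use finite_R in auto)
  also have "\<dots> = card D * (\<Sum>r\<in>R. \<Sum>t\<in>D. f (r((i, j) := t)))"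
    by (rule sum_resample[OF finite_I inI(1), where f = "\<lambda>r. \<Sum>t\<in>D. f (r((i, j) := t))"]) simp
  also have "(\<Sum>r\<in>R. \<Sum>t\<in>D. f (r((i, j) := t))) = card D * (\<Sum>r\<in>R. f r)"
    by (rule sum_resample[OF finite_I inI(2)]) simp
  also have "(\<Sum>r\<in>R. f r) = card {r \<in> R. pivot A r = j \<and> keeps K (cols r) n A i}"
    unfolding f_def by (rule card_filter[OF finite_R, symmetric])
  also have "card D * (card D * card {r \<in> R. pivot A r = j \<and> keeps K (cols r) n A i}) =
      9 ^ N * card {r \<in> R. pivot A r = j \<and> keeps K (cols r) n A i}"
    by (simp only: mult.assoc[symmetric] card_D)
  finally show ?thesis by (simp add: mult.commute)
qed

lemma card_keeps:
  assumes A: "A \<subseteq> {..<n}" "card A < K" and i: "i < n" "i \<notin> A"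
  shows "card (matches N) * card R \<le> 9 ^ N * card {r \<in> R. keeps K (cols r) n A i}"
proof -
  have finA: "finite A" using A finite_subset by blast
  have split: "card {r \<in> R. P r} = (\<Sum>j<K. card {r \<in> R. pivot A r = j \<and> P r})" for P
  proof -
    have "card {r \<in> R. P r} = card (\<Union>j<K. {r \<in> R. pivot A r = j \<and> P r})"
      using pivot(1)[OF finA A(2)] by (intro arg_cong[where f = card]) auto
    also have "\<dots> = (\<Sum>j<K. card {r \<in> R. pivot A r = j \<and> P r})"
      by (rule card_UN_disjoint) (use finite_R in auto)
    finally show ?thesis .
  qed
  have "card (matches N) * card R = (\<Sum>j<K. card (matches N) * card {r \<in> R. pivot A r = j})"
    using split[of "\<lambda>_. True"] by (simp add: sum_distrib_left)
  also have "\<dots> \<le> (\<Sum>j<K. 9 ^ N * card {r \<in> R. pivot A r = j \<and> keeps K (cols r) n A i})"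
    by (intro sum_mono card_pivot_keeps assms) auto
  also have "\<dots> = 9 ^ N * card {r \<in> R. keeps K (cols r) n A i}"
    unfolding split[of "\<lambda>r. keeps K (cols r) n A i"] by (rule sum_distrib_left[symmetric])
  finally show ?thesis .
qed

end

text \<open>On average, the columns keep a proportion of at least \<open>(1 - 1 / 9 ^ N) / 4\<close> of the pairs in \<open>P\<close>.
Since numbers of pairs are integers, taking \<open>9 ^ N\<close> larger than \<open>card P\<close> removes the error term.\<close>

lemma exists_dense_layer:
  assumes P: "finite P" and PA: "\<And>A i. (A, i) \<in> P \<Longrightarrow> A \<subseteq> {..<n} \<and> card A < K \<and> i < n \<and> i \<notin> A"
  shows "\<exists>c. generic K c {..n} \<and> card P \<le> 4 * card {(A, i) \<in> P. keeps K c n A i}"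
proof -
  obtain p where p: "prime p" "p > max n 3" using bigger_prime by blast
  have "\<not> 3 dvd p" using p primes_dvd_imp_eq[of 3 p] by auto
  then have p3: "\<not> 3 dvd int p" by presburger
  define N where "N = card P"
  interpret random_columns n K N "int p" by unfold_locales (rule p3)
  have "card P < 9 ^ N" unfolding N_def by (rule less_le_trans[OF less_exp]) (simp add: power_mono)
  let ?kept = "\<lambda>r. {(A, i) \<in> P. keeps K (cols r) n A i}"
  have "\<exists>r\<in>R. card P \<le> 4 * card (?kept r)"
  proof (rule ccontr)
    assume "\<not> ?thesis"
    then have few: "4 * card (?kept r) + 1 \<le> card P" if "r \<in> R" for r
      using that by force
    have kept: "?kept r = {q \<in> P. keeps K (cols r) n (fst q) (snd q)}" for r by auto
    have "(\<Sum>r\<in>R. card (?kept r)) = (\<Sum>r\<in>R. \<Sum>q\<in>P. of_bool (keeps K (cols r) n (fst q) (snd q)))"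
      unfolding kept by (intro sum.cong refl card_filter P)
    also have "\<dots> = (\<Sum>q\<in>P. \<Sum>r\<in>R. of_bool (keeps K (cols r) n (fst q) (snd q)))"
      by (rule sum.swap)
    also have "\<dots> = (\<Sum>q\<in>P. card {r \<in> R. keeps K (cols r) n (fst q) (snd q)})"
      by (intro sum.cong refl card_filter[symmetric] finite_R)
    finally have swap: "(\<Sum>r\<in>R. card (?kept r)) = (\<Sum>q\<in>P. card {r \<in> R. keeps K (cols r) n (fst q) (snd q)})" .
    have "card P * (card (matches N) * card R) = (\<Sum>q\<in>P. card (matches N) * card R)" by simp
    also have "\<dots> \<le> (\<Sum>q\<in>P. 9 ^ N * card {r \<in> R. keeps K (cols r) n (fst q) (snd q)})"
      using PA by (intro sum_mono card_keeps) (metis prod.collapse)+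
    also have "\<dots> = 9 ^ N * (\<Sum>r\<in>R. card (?kept r))" unfolding swap by (simp add: sum_distrib_left)
    finally have 1: "card P * (card (matches N) * card R) \<le> 9 ^ N * (\<Sum>r\<in>R. card (?kept r))" .
    have "4 * (\<Sum>r\<in>R. card (?kept r)) + card R = (\<Sum>r\<in>R. 4 * card (?kept r) + 1)"
      by (simp only: sum.distrib sum_distrib_left) simp
    also have "\<dots> \<le> (\<Sum>r\<in>R. card P)" by (intro sum_mono few)
    finally have 2: "4 * (\<Sum>r\<in>R. card (?kept r)) + card R \<le> card R * card P" by simp
    have R0: "card R > 0"
      using finite_R by (auto simp: card_gt_0_iff PiE_eq_empty_iff)
    have "9 ^ N * (4 * (\<Sum>r\<in>R. card (?kept r)) + card R) \<le> 9 ^ N * (card R * card P)"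
      using 2 by (rule mult_le_mono2)
    also have "\<dots> \<le> (4 * card (matches N) + 1) * (card R * card P)"
      using card_matches by (rule mult_le_mono1)
    also have "\<dots> = 4 * (card P * (card (matches N) * card R)) + card R * card P" by (simp add: algebra_simps)
    also have "\<dots> \<le> 4 * (9 ^ N * (\<Sum>r\<in>R. card (?kept r))) + card R * card P" using 1 by simp
    finally have "9 ^ N * card R \<le> card R * card P" by (simp add: algebra_simps)
    then show False using R0 \<open>card P < 9 ^ N\<close> by simp
  qed
  then obtain r where "card P \<le> 4 * card (?kept r)" by blast
  moreover have "generic K (cols r) {..n}"
    by (rule generic_if_vandermonde_mod[of "int p"]) (use p in \<open>auto simp: cols_def\<close>)
  ultimately show ?thesis by blast
qed

section \<open>The hypercube as a family of arcs between sets\<close>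

definition vertex :: "nat \<Rightarrow> nat set \<Rightarrow> bool list" where
  "vertex n A = map (\<lambda>i. i \<in> A) [0..<n]"

definition arcs :: "nat \<Rightarrow> (nat set \<times> nat) set" where
  "arcs n = {(A, i). A \<subseteq> {..<n} \<and> i < n \<and> i \<notin> A}"

definition edge_of :: "nat \<Rightarrow> nat set \<times> nat \<Rightarrow> bool list set" where
  "edge_of n = (\<lambda>(A, i). {vertex n A, vertex n (insert i A)})"

lemma length_vertex [simp]: "length (vertex n A) = n"
  by (simp add: vertex_def)

lemma nth_vertex [simp]: "i < n \<Longrightarrow> vertex n A ! i \<longleftrightarrow> i \<in> A"
  by (simp add: vertex_def)

lemma vertex_support: "length x = n \<Longrightarrow> vertex n {i. i < n \<and> x ! i} = x"
  by (rule nth_equalityI) auto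

lemma support_vertex: "A \<subseteq> {..<n} \<Longrightarrow> {i. i < n \<and> vertex n A ! i} = A"
  by auto

lemma vertex_eq_iff: "A \<subseteq> {..<n} \<Longrightarrow> B \<subseteq> {..<n} \<Longrightarrow> vertex n A = vertex n B \<longleftrightarrow> A = B"
  by (metis support_vertex)

lemma finite_arcs: "finite (arcs n)"
  by (rule finite_subset[of _ "Pow {..<n} \<times> {..<n}"]) (auto simp: arcs_def)

lemma edges_hypercube: "edges (hypercube n) = edge_of n ` arcs n"
proof
  show "edge_of n ` arcs n \<subseteq> edges (hypercube n)"
  proof
    fix e assume "e \<in> edge_of n ` arcs n"
    then obtain A i where e: "A \<subseteq> {..<n}" "i < n" "i \<notin> A" "e = {vertex n A, vertex n (insert i A)}"
      by (auto simp: arcs_def edge_of_def)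
    have "\<exists>!l. l < n \<and> vertex n A ! l \<noteq> vertex n (insert i A) ! l"
      by (rule ex1I[of _ i]) (use e in auto)
    then show "e \<in> edges (hypercube n)"
      unfolding e hypercube_def edges_def snd_conv mem_Collect_eq using length_vertex by blast
  qed
  show "edges (hypercube n) \<subseteq> edge_of n ` arcs n"
  proof
    fix e assume "e \<in> edges (hypercube n)"
    then obtain x y where e: "e = {x, y}" "length x = n" "length y = n"
      and "\<exists>!i. i < n \<and> x ! i \<noteq> y ! i"
      by (auto simp: hypercube_def edges_def)
    then obtain i where i: "i < n" "x ! i \<noteq> y ! i" "\<And>l. l < n \<Longrightarrow> l \<noteq> i \<Longrightarrow> x ! l = y ! l"
      by metis
    have *: "{x, y} \<in> edge_of n ` arcs n"
      if x: "length x = n" "\<not> x ! i" and y: "length y = n" "y ! i"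
        and eq: "\<And>l. l < n \<Longrightarrow> l \<noteq> i \<Longrightarrow> x ! l = y ! l" for x y
    proof -
      let ?A = "{l. l < n \<and> x ! l}"
      have "insert i ?A = {l. l < n \<and> y ! l}" using i(1) x y eq by auto
      then have q: "{x, y} = edge_of n (?A, i)"
        using vertex_support[OF x(1)] vertex_support[OF y(1)] by (simp add: edge_of_def)
      have "(?A, i) \<in> arcs n" using i(1) x by (auto simp: arcs_def)
      with q show ?thesis by (rule image_eqI)
    qed
    show "e \<in> edge_of n ` arcs n"
    proof (cases "x ! i")
      case True
      then have "{y, x} \<in> edge_of n ` arcs n" using i e by (intro *) auto
      then show ?thesis by (simp add: e(1) insert_commute)
    next
      case False
      then show ?thesis unfolding e(1) using i e by (intro *) auto
    qed
  qed
qed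

lemma inj_edge_of: "inj_on (edge_of n) (arcs n)"
proof (rule inj_onI)
  fix q q' assume q: "q \<in> arcs n" "q' \<in> arcs n" "edge_of n q = edge_of n q'"
  obtain A i B j where e: "q = (A, i)" "q' = (B, j)" by (cases q, cases q')
  have A: "A \<subseteq> {..<n}" "insert i A \<subseteq> {..<n}" "i \<notin> A" and B: "B \<subseteq> {..<n}" "insert j B \<subseteq> {..<n}" "j \<notin> B"
    using q e by (auto simp: arcs_def)
  have "(A = B \<and> insert i A = insert j B) \<or> (A = insert j B \<and> insert i A = B)"
    using q(3) vertex_eq_iff[OF A(1) B(1)] vertex_eq_iff[OF A(2) B(2)] vertex_eq_iff[OF A(1) B(2)]
      vertex_eq_iff[OF A(2) B(1)]
    unfolding e edge_of_def by (simp add: doubleton_eq_iff)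
  then have "A = B" "insert i A = insert j B" using A(3) B(3) by blast+
  then show "q = q'" using A(3) B(3) e by blast
qed

lemma num_edges_hypercube: "num_edges (hypercube n) = card (arcs n)"
  by (simp add: num_edges_def edges_hypercube card_image inj_edge_of)

text \<open>Toggling an element different from \<open>i\<close> is an involution that changes the parity of \<open>card A\<close>. Such
an element exists because \<open>n \<ge> 2\<close>.\<close>

lemma card_even_arcs:
  assumes "n \<ge> 2"
  shows "2 * card {q \<in> arcs n. even (card (fst q))} = card (arcs n)"
proof -
  define other :: "nat \<Rightarrow> nat" where "other i = (if i = 0 then 1 else 0)" for i
  define tog :: "nat set \<times> nat \<Rightarrow> nat set \<times> nat" where
    "tog = (\<lambda>(A, i). (if other i \<in> A then A - {other i} else insert (other i) A, i))"
  have other: "other i < n" "other i \<noteq> i" "i \<noteq> other i" for i using assms by (auto simp: other_def)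
  have tog_arcs: "tog q \<in> arcs n" if "q \<in> arcs n" for q
    using that other by (auto simp: tog_def arcs_def split: prod.splits)
  have tog_tog: "tog (tog q) = q" for q
    by (auto simp: tog_def split: prod.splits)
  have tog_par: "even (card (fst (tog q))) \<longleftrightarrow> odd (card (fst q))" if "q \<in> arcs n" for q
  proof -
    obtain A i where q: "q = (A, i)" by (cases q)
    have fin: "finite A" using that q by (auto simp: arcs_def intro: finite_subset)
    show ?thesis
    proof (cases "other i \<in> A")
      case True
      then have "card A = Suc (card (A - {other i}))" using fin by (intro card.remove)
      then show ?thesis using True by (simp add: q tog_def)
    next
      case False
      then show ?thesis using fin by (simp add: q tog_def)
    qed
  qed
  have "bij_betw tog {q \<in> arcs n. even (card (fst q))} {q \<in> arcs n. odd (card (fst q))}"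
    by (rule bij_betw_byWitness[where f' = tog]) (use tog_tog tog_arcs tog_par in auto)
  then have "card {q \<in> arcs n. even (card (fst q))} = card {q \<in> arcs n. odd (card (fst q))}"
    by (rule bij_betw_same_card)
  moreover have "card (arcs n) = card ({q \<in> arcs n. even (card (fst q))} \<union> {q \<in> arcs n. odd (card (fst q))})"
    by (rule arg_cong[where f = card]) auto
  moreover have "\<dots> = card {q \<in> arcs n. even (card (fst q))} + card {q \<in> arcs n. odd (card (fst q))}"
    by (rule card_Un_disjoint) (use finite_arcs in auto)
  ultimately show ?thesis by simp
qed

section \<open>The kept subgraph\<close>

text \<open>All arcs from the empty set are kept, and for well-chosen columns a quarter of each other even
layer. The
additional index \<open>w\<close> of the columns is \<open>n\<close>.\<close>

definition kept :: "nat \<Rightarrow> (nat \<Rightarrow> nat \<Rightarrow> nat \<Rightarrow> int) \<Rightarrow> (nat set \<times> nat) set" where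
  "kept n c = {(A, i) \<in> arcs n. even (card A) \<and> (A = {} \<or> keeps (Suc (card A)) (c (card A)) n A i)}"

definition kept_graph :: "nat \<Rightarrow> (nat \<Rightarrow> nat \<Rightarrow> nat \<Rightarrow> int) \<Rightarrow> bool list graph" where
  "kept_graph n c = ({x. length x = n}, edge_of n ` kept n c)"

lemma kept_arcs: "kept n c \<subseteq> arcs n"
  by (auto simp: kept_def)

lemma subgraph_kept_graph: "subgraph (kept_graph n c) (hypercube n)"
proof -
  have "edges (kept_graph n c) \<subseteq> edges (hypercube n)"
    using kept_arcs unfolding edges_hypercube by (auto simp: kept_graph_def edges_def)
  moreover have "verts (kept_graph n c) = verts (hypercube n)"
    by (simp add: kept_graph_def hypercube_def verts_def)
  ultimately show ?thesis
    using is_graph_hypercube[of n] unfolding subgraph_def is_graph_def by auto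
qed

lemma num_edges_kept_graph: "num_edges (kept_graph n c) = card (kept n c)"
  unfolding num_edges_def kept_graph_def edges_def snd_conv
  by (rule card_image) (rule inj_on_subset[OF inj_edge_of kept_arcs])

text \<open>Each even layer contributes at least a quarter of its arcs, layer 0 contributes all of them, and
the even layers together contain half of all arcs.\<close>

lemma card_kept:
  assumes "n \<ge> 2"
    and dense: "\<And>k. card {q \<in> arcs n. card (fst q) = k} \<le>
      4 * card {(A, i) \<in> {q \<in> arcs n. card (fst q) = k}. keeps (Suc k) (c k) n A i}"
  shows "card (arcs n) < 8 * card (kept n c)"
proof -
  define Lay where "Lay k = {q \<in> arcs n. card (fst q) = k}" for k
  define E where "E = {k. k \<le> n \<and> even k}"
  have finL: "finite (Lay k)" for k using finite_arcs by (simp add: Lay_def)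
  have finE: "finite E" by (simp add: E_def)
  have cardn: "card (fst q) \<le> n" if "q \<in> arcs n" for q
    using that card_mono[of "{..<n}" "fst q"] by (auto simp: arcs_def)
  have even: "{q \<in> arcs n. even (card (fst q))} = (\<Union>k\<in>E. Lay k)"
    using cardn by (auto simp: E_def Lay_def)
  have kept: "kept n c = (\<Union>k\<in>E. kept n c \<inter> Lay k)"
    using cardn by (fastforce simp: E_def Lay_def kept_def)
  have le: "card (Lay k) \<le> 4 * card (kept n c \<inter> Lay k)" if "k \<in> E" for k
  proof -
    have "{(A, i) \<in> Lay k. keeps (Suc k) (c k) n A i} \<subseteq> kept n c \<inter> Lay k"
      using that by (auto simp: Lay_def kept_def E_def)
    then have "card {(A, i) \<in> Lay k. keeps (Suc k) (c k) n A i} \<le> card (kept n c \<inter> Lay k)"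
      using finL by (intro card_mono) auto
    then show ?thesis using dense[of k] unfolding Lay_def[symmetric] by linarith
  qed
  have less: "card (Lay 0) < 4 * card (kept n c \<inter> Lay 0)"
  proof -
    have "fst q = {}" if "q \<in> Lay 0" for q
      using that finite_subset[of "fst q" "{..<n}"] by (auto simp: Lay_def arcs_def)
    then have "kept n c \<inter> Lay 0 = Lay 0" by (force simp: Lay_def kept_def)
    moreover have "({}, 0) \<in> Lay 0" using assms(1) by (simp add: Lay_def arcs_def)
    then have "card (Lay 0) > 0" using finL by (auto simp: card_gt_0_iff)
    ultimately show ?thesis by simp
  qed
  have "card {q \<in> arcs n. even (card (fst q))} = (\<Sum>k\<in>E. card (Lay k))"
    unfolding even by (rule card_UN_disjoint) (use finE finL in \<open>auto simp: Lay_def\<close>)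
  also have "\<dots> < (\<Sum>k\<in>E. 4 * card (kept n c \<inter> Lay k))"
    by (rule sum_strict_mono_ex1[OF finE]) (use le less in \<open>auto simp: E_def\<close>)
  also have "\<dots> = 4 * (\<Sum>k\<in>E. card (kept n c \<inter> Lay k))" by (rule sum_distrib_left[symmetric])
  also have "(\<Sum>k\<in>E. card (kept n c \<inter> Lay k)) = card (kept n c)"
    by (subst (2) kept, rule card_UN_disjoint[symmetric]) (use finE finL in \<open>auto simp: Lay_def\<close>)
  finally show ?thesis using card_even_arcs[OF assms(1)] by linarith
qed

text \<open>Numbering the vertices of a cycle by all natural numbers, periodically, avoids wrap-around cases.\<close>

lemma copy_of_cycle:
  assumes "isomorphic C (cycle_graph k)" "k > 0"
  obtains v :: "nat \<Rightarrow> 'a" where "\<And>t. v t \<in> verts C" "\<And>t. v (t + k) = v t"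
    "\<And>t. {v t, v (t + 1)} \<in> edges C" "\<And>s t. v s = v t \<longleftrightarrow> s mod k = t mod k"
proof -
  obtain f where f: "bij_betw f (verts C) (verts (cycle_graph k))"
    and e: "\<And>x y. x \<in> verts C \<Longrightarrow> y \<in> verts C \<Longrightarrow> {x, y} \<in> edges C \<longleftrightarrow> {f x, f y} \<in> edges (cycle_graph k)"
    using assms(1) unfolding isomorphic_def by blast
  have vk: "verts (cycle_graph k) = {..<k}" by (simp add: cycle_graph_def verts_def)
  define v where "v t = inv_into (verts C) f (t mod k)" for t
  have v: "v t \<in> verts C" "f (v t) = t mod k" for t
    using f assms(2) unfolding v_def vk bij_betw_def by (auto intro: inv_into_into f_inv_into_f)
  show thesis
  proof
    show "v t \<in> verts C" for t by (rule v)
    show "v (t + k) = v t" for t by (simp add: v_def)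
    show "v s = v t \<longleftrightarrow> s mod k = t mod k" for s t using v(2) v_def by metis
    have "{f (v t), f (v (t + 1))} \<in> edges (cycle_graph k)" for t
    proof -
      have eq: "(t + 1) mod k = (t mod k + 1) mod k" by (simp add: mod_simps)
      have "t mod k < k" using assms(2) by simp
      then show ?thesis unfolding v(2) eq cycle_graph_def edges_def snd_conv by blast
    qed
    then show "{v t, v (t + 1)} \<in> edges C" for t using e v(1) by blast
  qed
qed

text \<open>Along a cycle of kept edges the parity of the cardinality alternates, and an edge only joins an
even set to a larger odd one. So the cycle moves between one even layer and the next layer, where
\<open>no_kept_cycle\<close> applies. The layer is not layer 0, in which all even sets are empty.\<close>

lemma kept_graph_free:
  assumes gen: "\<And>k. generic (Suc k) (c k) {..n}"
  shows "free_of (cycle_graph 10) (kept_graph n c)"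
  unfolding free_of_def
proof
  assume "\<exists>C. is_copy C (cycle_graph 10) (kept_graph n c)"
  then obtain C where C: "subgraph C (kept_graph n c)" "isomorphic C (cycle_graph 10)"
    by (auto simp: is_copy_def)
  obtain v :: "nat \<Rightarrow> bool list" where v: "\<And>t. v t \<in> verts C" "\<And>t. v (t + 10) = v t" "\<And>t. {v t, v (t + 1)} \<in> edges C"
    "\<And>s t. v s = v t \<longleftrightarrow> s mod 10 = t mod 10"
    by (rule copy_of_cycle[OF C(2) zero_less_numeral]) blast
  define V where "V t = {i. i < n \<and> v t ! i}" for t
  have Vn: "V t \<subseteq> {..<n}" for t by (auto simp: V_def)
  have len: "length (v t) = n" for t
    using v(1)[of t] C(1) by (auto simp: subgraph_def kept_graph_def verts_def)
  have vertex_V: "vertex n (V t) = v t" for t unfolding V_def by (rule vertex_support[OF len])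
  have V_eq: "V s = V t \<longleftrightarrow> s mod 10 = t mod 10" for s t
  proof -
    have "V s = V t \<Longrightarrow> v s = v t" using vertex_V[of s] vertex_V[of t] by simp
    moreover have "v s = v t \<Longrightarrow> V s = V t" by (simp add: V_def)
    ultimately show ?thesis using v(4)[of s t] by blast
  qed
  have V_per: "V (t + 10) = V t" for t by (simp add: V_def v(2))
  have step: "\<exists>A i. (A, i) \<in> kept n c \<and> (V t = A \<and> V (t + 1) = insert i A \<or> V (t + 1) = A \<and> V t = insert i A)"
    for t
  proof -
    have "{v t, v (t + 1)} \<in> edge_of n ` kept n c"
      using v(3)[of t] C(1) by (auto simp: subgraph_def kept_graph_def edges_def)
    then obtain A i where k: "(A, i) \<in> kept n c" "{v t, v (t + 1)} = {vertex n A, vertex n (insert i A)}"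
      by (auto simp: edge_of_def)
    have A: "A \<subseteq> {..<n}" "insert i A \<subseteq> {..<n}" using k(1) by (auto simp: kept_def arcs_def)
    have "V t = A \<and> V (t + 1) = insert i A \<or> V (t + 1) = A \<and> V t = insert i A"
      using k(2) unfolding vertex_V[symmetric] doubleton_eq_iff
        vertex_eq_iff[OF Vn A(1)] vertex_eq_iff[OF Vn A(2)] by blast
    then show ?thesis using k(1) by blast
  qed
  have keptD: "even (card A)" "card (insert i A) = Suc (card A)" "i \<notin> A"
      "A \<noteq> {} \<Longrightarrow> keeps (Suc (card A)) (c (card A)) n A i" if "(A, i) \<in> kept n c" for A i
    using that finite_subset[of A "{..<n}"] by (auto simp: kept_def arcs_def)
  \<comment> \<open>The numbering is shifted by one if necessary, so that the even positions carry the even sets.\<close>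
  define s0 :: nat where "s0 = (if even (card (V 0)) then 0 else 1)"
  have par_step: "even (card (V (t + 1))) \<longleftrightarrow> odd (card (V t))" for t
    using step[of t] keptD by (metis even_Suc)
  have par: "even (card (V t)) \<longleftrightarrow> even (t + s0)" for t
  proof (induction t)
    case (Suc t)
    then show ?case using par_step[of t] by simp
  qed (simp add: s0_def)
  define A where "A t = V (2 * t + s0)" for t
  define B where "B t = V (2 * t + s0 + 1)" for t
  have A1: "A (t + 1) = V (2 * t + s0 + 1 + 1)" for t by (simp add: A_def algebra_simps)
  have evA: "even (card (A t))" and oddB: "odd (card (B t))" for t
    unfolding A_def B_def by (simp_all add: par)
  have up: "\<exists>i. (A t, i) \<in> kept n c \<and> B t = insert i (A t)" for t
    using step[of "2 * t + s0"] evA[of t] oddB[of t] keptD(1) unfolding A_def B_def by metis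
  have down: "\<exists>i. (A (t + 1), i) \<in> kept n c \<and> B t = insert i (A (t + 1))" for t
    using step[of "2 * t + s0 + 1"] evA[of "t + 1"] oddB[of t] keptD(1)
    unfolding A1 B_def by metis
  have V_neq: "V t \<noteq> V (t + 2)" for t
    unfolding V_eq using mod_eq_dvd_iff_nat[of t "t + 2" 10] by auto
  have neq: "A t \<noteq> A (t + 1)" "B t \<noteq> B (t + 1)" for t
    using V_neq[of "2 * t + s0"] V_neq[of "2 * t + s0 + 1"] by (simp_all add: A_def B_def)
  have card_step: "card (A (t + 1)) = card (A t)" for t
    using up[of t] down[of t] keptD(2) by (metis Suc_inject)
  define k where "k = card (A 0)"
  have card_A: "card (A t) = k" for t
    by (induction t) (use card_step in \<open>auto simp: k_def\<close>)
  have fin: "finite (A t)" for t using Vn finite_subset unfolding A_def by blast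
  have ne: "A t \<noteq> {}" for t
  proof
    assume "A t = {}"
    then have "k = 0" using card_A[of t] by simp
    then have "A s = {}" for s using card_A[of s] fin by simp
    then show False using neq(1)[of 0] by simp
  qed
  show False
  proof (rule no_kept_cycle[OF gen[of k], of n A B])
    fix t
    show "A t \<subseteq> {..n} - {n}" using Vn[of "2 * t + s0"] by (auto simp: A_def)
    show "finite (A t)" "Suc (card (A t)) = Suc k" by (simp_all add: fin card_A)
    show "A (t + 5) = A t" "B (t + 5) = B t"
      using V_per[of "2 * t + s0"] V_per[of "2 * t + s0 + 1"]
      by (simp_all add: A_def B_def algebra_simps)
    show "\<exists>i. i \<notin> A t \<and> B t = insert i (A t) \<and> keeps (Suc k) (c k) n (A t) i"
      using up[of t] keptD(3,4) ne card_A by metis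
    show "\<exists>i. i \<notin> A (t + 1) \<and> B t = insert i (A (t + 1)) \<and> keeps (Suc k) (c k) n (A (t + 1)) i"
      using down[of t] keptD(3,4) ne card_A by metis
    show "A t \<noteq> A (t + 1)" "B t \<noteq> B (t + 1)" by (rule neq)+
  qed simp
qed

theorem theorem1p2:
  fixes n :: nat
  assumes "n \<ge> 2"
  shows "real (ex_num (hypercube n) (cycle_graph 10)) > 1 / 8 * real (num_edges (hypercube n))"
proof -
  define dense where "dense k c \<longleftrightarrow> card {q \<in> arcs n. card (fst q) = k} \<le>
      4 * card {(A, i) \<in> {q \<in> arcs n. card (fst q) = k}. keeps (Suc k) c n A i}" for k c
  have "\<forall>k. \<exists>c. generic (Suc k) c {..n} \<and> dense k c"
    unfolding dense_def
    by (intro allI exists_dense_layer) (use finite_arcs in \<open>auto simp: arcs_def\<close>)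
  then obtain c where c: "\<forall>k. generic (Suc k) (c k) {..n} \<and> dense k (c k)"
    by (elim exE[OF choice])
  then have gen: "generic (Suc k) (c k) {..n}" for k by blast
  have "num_edges (kept_graph n c) \<in>
      {num_edges F | F. subgraph F (hypercube n) \<and> free_of (cycle_graph 10) F}"
    using subgraph_kept_graph kept_graph_free[OF gen] by blast
  moreover have "finite (edges (hypercube n))" by (simp add: edges_hypercube finite_arcs)
  ultimately have "num_edges (kept_graph n c) \<le> ex_num (hypercube n) (cycle_graph 10)"
    unfolding ex_num_def by (intro Max_ge ex_num_set_finite)
  moreover have "num_edges (hypercube n) < 8 * num_edges (kept_graph n c)"
    using card_kept[OF assms, of c] c unfolding dense_def by (simp add: num_edges_hypercube num_edges_kept_graph)
  ultimately show ?thesis by linarith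
qed

end
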